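(* Let $\overline{g}$ be a Gowdy spacetime metric in the areal time gauge, with data $(e, G, L, h)$ over $B = (0,t_0] \times Y$, $Y = S^1$, as described in the context; in particular $\overline{g}$ is Ricci-flat and $\det G = t^N$. Put $t = e^{-\tau}$ and $t_0 = e^{-\tau_0}$. Then $$\int_{\tau_0}^\infty e^{N\tau} \left\| (G^{-1} G_\tau)_\tau \right\|^2_{H^{-1}_{\tau}} \, d\tau < \infty .$$
   Context: Setting (Gowdy spacetime with $N$-dimensional orbits, possibly globally twisted). Let $N \ge 1$, $Y = S^1$ and $B = (0,t_0] \times Y$. Let $e$ be a flat real vector bundle of rank $N$ on $B$ with holonomy in $\mathrm{SL}(N,\mathbb{R})$. The spacetime fibers over $B$, with fibers $N$-dimensional abelian Lie group orbits (for example, it is the total space of a $T^N$-bundle on $B$, in which case $e$ is the trivial flat bundle), and the smooth Lorentzian metric is invariant under the (locally defined) free fiberwise group action. The Gowdy condition is that the normal spaces to the orbits form an integrable distribution, so that in local coordinates $$\overline{g} = \sum_{I,J=1}^N G_{IJ}\, dx^I dx^J - L^2 dt^2 + h\, dy^2 ,$$ where $y$ is a local coordinate on $Y$, $x^1,\dots,x^N$ are linear coordinates along the fibers (corresponding to a local flat unimodular frame of $e$), and $G = (G_{IJ})$, $L > 0$, $h > 0$ depend only on $(t,y)$. The matrix $G$ is symmetric and positive definite; it is the local expression of a Euclidean inner product on $e$. As $e$ is unimodular, $\det G$ is a globally defined function. One assumes that $\overline{g}$ is Ricci-flat (vacuum) and that the time coordinate $t \in (0,t_0]$ is chosen so that $\det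 G = t^N$. The density $\mu = L^{-1}\sqrt{\det G}\,(\partial_t \ln\det G)\, h^{1/2}\, dy$ on $Y$ is then a $t$-independent smooth positive density. Notation. Subscripts $\tau$, $y$ on $G$ and on endomorphisms denote partial derivatives in local flat frames of $e$. A section $\sigma$ of $\mathrm{End}(e)$ is called self-adjoint if locally $\sigma^T = G\sigma G^{-1}$ (self-adjointness with respect to the inner product $G$). For such $\sigma$, put $D_y\sigma = \sigma_y + \frac12 [G^{-1}G_y, \sigma]$, and let $\mathrm{Tr}(D_Y\sigma\otimes D_Y\sigma) = \mathrm{Tr}((D_y\sigma)^2)\, dy^2$, a $2$-density on $Y$; its quotient by $\mu$ is a density on $Y$. The time-$\tau$ norm of a square-integrable self-adjoint section $\eta$ over $\{\tau\}\times Y$ is $$\|\eta\|_{H^{-1}_{\tau}} = \sup_{\widehat\eta\neq 0} \frac{\int_Y \mathrm{Tr}(\eta\widehat\eta)\, d\mu}{\sqrt{\int_Y \left( \mathrm{Tr}(\widehat\eta^2)\, d\mu + \frac{\mathrm{Tr}(D_Y\widehat\eta\otimes D_Y\widehat\eta)}{\mu}\right)}},$$ where $\widehat\eta$ ranges over smooth self-adjoint sections of $\mathrm{End}(e)$ over the time-$\tau$ slice and $G = G(\tau)$ is used in the definitions of self-adjointness and $D_Y$. *)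

theory Defs
  imports "HOL-Analysis.Analysis"
begin

text \<open>
  The domains used below are the line and strips such as \<open>{0<..t0} \<times> UNIV\<close>. These are convex with
  nonempty interior, so a derivative taken within them is unique, and \<open>smooth_on\<close>
  amounts to smoothness up to the boundary (one-sided derivatives at \<open>t = t0\<close>).
\<close>

primrec Ck_on :: "nat \<Rightarrow> 'a::real_normed_vector set \<Rightarrow> ('a \<Rightarrow> 'b::real_normed_vector) \<Rightarrow> bool" where
  "Ck_on 0 S f \<longleftrightarrow> continuous_on S f"
| "Ck_on (Suc k) S f \<longleftrightarrow>
     (\<exists>f'. (\<forall>x\<in>S. (f has_derivative f' x) (at x within S)) \<and> (\<forall>v. Ck_on k S (\<lambda>x. f' x v)))"

definition smooth_on :: "'a::real_normed_vector set \<Rightarrow> ('a \<Rightarrow> 'b::real_normed_vector) \<Rightarrow> bool" where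
  "smooth_on S f \<longleftrightarrow> (\<forall>k. Ck_on k S f)"

text \<open>
  Here \<open>S\<close> is the coordinate domain and \<open>g p\<close> the matrix of metric components at \<open>p \<in> S\<close>.
  Partial derivatives are one-sided where \<open>S\<close> only allows that.
\<close>

definition partial_deriv ::
  "(real^'m) set \<Rightarrow> 'm::finite \<Rightarrow> (real^'m \<Rightarrow> real) \<Rightarrow> real^'m \<Rightarrow> real" where
  "partial_deriv S k f p =
     vector_derivative (\<lambda>s. f (p + s *\<^sub>R axis k 1)) (at 0 within {s. p + s *\<^sub>R axis k 1 \<in> S})"

definition christoffel ::
  "(real^'m) set \<Rightarrow> (real^'m \<Rightarrow> real^'m^'m) \<Rightarrow> 'm::finite \<Rightarrow> 'm \<Rightarrow> 'm \<Rightarrow> real^'m \<Rightarrow> real" where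
  "christoffel S g k i j p =
     (\<Sum>l\<in>UNIV. matrix_inv (g p) $ k $ l *
        (partial_deriv S i (\<lambda>q. g q $ j $ l) p + partial_deriv S j (\<lambda>q. g q $ i $ l) p
          - partial_deriv S l (\<lambda>q. g q $ i $ j) p)) / 2"

definition ricci ::
  "(real^'m) set \<Rightarrow> (real^'m \<Rightarrow> real^'m^'m) \<Rightarrow> 'm::finite \<Rightarrow> 'm \<Rightarrow> real^'m \<Rightarrow> real" where
  "ricci S g i j p =
     (\<Sum>k\<in>UNIV. partial_deriv S k (christoffel S g k i j) p)
     - (\<Sum>k\<in>UNIV. partial_deriv S j (christoffel S g k i k) p)
     + (\<Sum>k\<in>UNIV. \<Sum>l\<in>UNIV. christoffel S g k k l p * christoffel S g l i j p)
     - (\<Sum>k\<in>UNIV. \<Sum>l\<in>UNIV. christoffel S g k j l p * christoffel S g l i k p)"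

datatype 'n coord = TC | YC | XC 'n

instance coord :: (finite) finite
proof
  have "(UNIV :: 'a coord set) = insert TC (insert YC (range XC))"
    using coord.exhaust by blast
  then show "finite (UNIV :: 'a coord set)"
    by (metis finite finite_imageI finite_insert)
qed

definition spacetime_domain :: "real \<Rightarrow> (real^('n::finite coord)) set" where
  "spacetime_domain t0 = {p. 0 < p $ TC \<and> p $ TC \<le> t0}"

definition gowdy_metric ::
  "(real \<Rightarrow> real \<Rightarrow> real^'n^'n) \<Rightarrow> (real \<Rightarrow> real \<Rightarrow> real) \<Rightarrow> (real \<Rightarrow> real \<Rightarrow> real) \<Rightarrow>
   real^('n::finite coord) \<Rightarrow> real^('n coord)^('n coord)" where
  "gowdy_metric G L h p = (\<chi> i j.
     (case (i, j) of
        (XC I, XC J) \<Rightarrow> G (p $ TC) (p $ YC) $ I $ J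
      | (TC, TC) \<Rightarrow> - (L (p $ TC) (p $ YC))\<^sup>2
      | (YC, YC) \<Rightarrow> h (p $ TC) (p $ YC)
      | _ \<Rightarrow> 0))"

text \<open>
  The circle \<open>Y\<close> is \<open>\<real>/\<int>\<close>. A flat rank-\<open>N\<close> bundle \<open>e\<close> on \<open>(0,t0] \<times> Y\<close> is determined by its
  holonomy \<open>A\<close> around \<open>Y\<close>: pulled back to \<open>(0,t0] \<times> \<real>\<close> it has a global flat frame, in which
  the fiber coordinates over \<open>(t, y + 1)\<close> and \<open>(t, y)\<close> are related by \<open>x \<mapsto> A x\<close>. All objects over
  \<open>(0,t0] \<times> Y\<close> are represented by their lifts, as functions of \<open>t\<close> and \<open>y :: real\<close> with the
  corresponding equivariance; values outside \<open>0 < t \<le> t0\<close> are irrelevant. The coordinate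
  expression of the metric does not involve \<open>x\<close>, so its Ricci tensor may be computed in the
  coordinates \<open>(t, y, x) \<in> (0,t0] \<times> \<real> \<times> \<real>\<^sup>N\<close>, whatever the global form of the fibers is.
\<close>

locale gowdy_spacetime =
  fixes t0 :: real
    and A :: "real^'n::finite^'n"
    and G :: "real \<Rightarrow> real \<Rightarrow> real^'n^'n"
    and L h :: "real \<Rightarrow> real \<Rightarrow> real"
  assumes t0_pos: "0 < t0"
    and holonomy_SL: "det A = 1"
    and smooth_G: "smooth_on ({0<..t0} \<times> UNIV) (\<lambda>(t, y). G t y)"
    and smooth_L: "smooth_on ({0<..t0} \<times> UNIV) (\<lambda>(t, y). L t y)"
    and smooth_h: "smooth_on ({0<..t0} \<times> UNIV) (\<lambda>(t, y). h t y)"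
    and equivariant_G: "\<And>t y. t \<in> {0<..t0} \<Longrightarrow> G t (y + 1) = transpose A ** G t y ** A"
    and periodic_L: "\<And>t y. t \<in> {0<..t0} \<Longrightarrow> L t (y + 1) = L t y"
    and periodic_h: "\<And>t y. t \<in> {0<..t0} \<Longrightarrow> h t (y + 1) = h t y"
    and symmetric_G: "\<And>t y. t \<in> {0<..t0} \<Longrightarrow> transpose (G t y) = G t y"
    and posdef_G: "\<And>t y v. t \<in> {0<..t0} \<Longrightarrow> v \<noteq> 0 \<Longrightarrow> 0 < v \<bullet> (G t y *v v)"
    and pos_L: "\<And>t y. t \<in> {0<..t0} \<Longrightarrow> 0 < L t y"
    and pos_h: "\<And>t y. t \<in> {0<..t0} \<Longrightarrow> 0 < h t y"
    and ricci_flat: "\<And>i j p. p \<in> spacetime_domain t0 \<Longrightarrow>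
          ricci (spacetime_domain t0) (gowdy_metric G L h) i j p = 0"
    and areal: "\<And>t y. t \<in> {0<..t0} \<Longrightarrow> det (G t y) = t ^ CARD('n)"

text \<open>
  The coefficient of \<open>dy\<close> in the density \<open>\<mu>\<close>. That it does not depend on \<open>t\<close> is a consequence of
  Ricci-flatness and the areal gauge, and is not built in here.
\<close>

definition gowdy_density ::
  "real \<Rightarrow> (real \<Rightarrow> real \<Rightarrow> real^'n::finite^'n) \<Rightarrow> (real \<Rightarrow> real \<Rightarrow> real) \<Rightarrow> (real \<Rightarrow> real \<Rightarrow> real) \<Rightarrow>
   real \<Rightarrow> real \<Rightarrow> real" where
  "gowdy_density t0 G L h t y =
     inverse (L t y) * sqrt (det (G t y)) *
     vector_derivative (\<lambda>s. ln (det (G s y))) (at t within {0<..t0}) * sqrt (h t y)"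

text \<open>
  Below, \<open>g\<close> is the inner product \<open>G\<close> on a fixed time slice, as a function of \<open>y\<close>, and \<open>m\<close> is the
  coefficient of \<open>dy\<close> in \<open>\<mu>\<close>. Integrals over \<open>Y\<close> are integrals over the fundamental domain \<open>{0..1}\<close>.
\<close>

definition self_adjoint_section ::
  "(real \<Rightarrow> real^'n::finite^'n) \<Rightarrow> (real \<Rightarrow> real^'n^'n) \<Rightarrow> bool" where
  "self_adjoint_section g \<sigma> \<longleftrightarrow> (\<forall>y. transpose (\<sigma> y) = g y ** \<sigma> y ** matrix_inv (g y))"

definition smooth_End_section :: "real^'n::finite^'n \<Rightarrow> (real \<Rightarrow> real^'n^'n) \<Rightarrow> bool" where
  "smooth_End_section A \<sigma> \<longleftrightarrow>
     smooth_on UNIV \<sigma> \<and> (\<forall>y. \<sigma> (y + 1) = matrix_inv A ** \<sigma> y ** A)"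

definition cov_deriv ::
  "(real \<Rightarrow> real^'n::finite^'n) \<Rightarrow> (real \<Rightarrow> real^'n^'n) \<Rightarrow> real \<Rightarrow> real^'n^'n" where
  "cov_deriv g \<sigma> y =
     (let a = matrix_inv (g y) ** vector_derivative g (at y)
      in vector_derivative \<sigma> (at y) + (1/2) *\<^sub>R (a ** \<sigma> y - \<sigma> y ** a))"

definition H1_norm ::
  "(real \<Rightarrow> real^'n::finite^'n) \<Rightarrow> (real \<Rightarrow> real) \<Rightarrow> (real \<Rightarrow> real^'n^'n) \<Rightarrow> real" where
  "H1_norm g m \<sigma> = sqrt (integral {0..1} (\<lambda>y.
     trace (\<sigma> y ** \<sigma> y) * m y + trace (cov_deriv g \<sigma> y ** cov_deriv g \<sigma> y) / m y))"

text \<open>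
  \<open>ennreal\<close> truncates negative quotients to \<open>0\<close>; this does not affect the supremum, because the
  quotient changes sign under \<open>\<sigma> \<mapsto> - \<sigma>\<close>.
\<close>

definition Hminus1_norm ::
  "real^'n::finite^'n \<Rightarrow> (real \<Rightarrow> real^'n^'n) \<Rightarrow> (real \<Rightarrow> real) \<Rightarrow> (real \<Rightarrow> real^'n^'n) \<Rightarrow> ennreal" where
  "Hminus1_norm A g m \<eta> =
     (SUP \<sigma> \<in> {\<sigma>. smooth_End_section A \<sigma> \<and> self_adjoint_section g \<sigma> \<and> \<sigma> \<noteq> (\<lambda>y. 0)}.
        ennreal (integral {0..1} (\<lambda>y. trace (\<eta> y ** \<sigma> y) * m y) / H1_norm g m \<sigma>))"

definition Ginv_Gtau_tau ::
  "real \<Rightarrow> (real \<Rightarrow> real \<Rightarrow> real^'n::finite^'n) \<Rightarrow> real \<Rightarrow> real \<Rightarrow> real^'n^'n" where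
  "Ginv_Gtau_tau \<tau>0 G \<tau> y =
     vector_derivative
       (\<lambda>s. matrix_inv (G (exp (- s)) y) **
            vector_derivative (\<lambda>r. G (exp (- r)) y) (at s within {\<tau>0..}))
       (at \<tau> within {\<tau>0..})"

end

theory Submission
  imports Defs
begin

text \<open>
  Put \<open>X = G\<^sup>-\<^sup>1G\<^sub>t\<close>, \<open>Y = G\<^sup>-\<^sup>1G\<^sub>y\<close>. The fiber components of the Ricci tensor give one matrix equation, whose
  trace says that \<open>\<mu>\<close> does not depend on \<open>t\<close>. In terms of \<open>\<tau>\<close>, with \<open>U = G\<^sup>-\<^sup>1G\<^sub>\<tau>\<close> and \<open>V = G\<^sup>-\<^sup>1G\<^sub>y\<close>, it is
  the wave equation \<open>\<mu> U\<^sub>\<tau> = N\<^sup>2 exp (- N \<tau>) (V / \<mu>)\<^sub>y\<close>. The energy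
  \<open>\<integral> Tr (U\<^sup>2) \<mu> + N\<^sup>2 exp (- N \<tau>) \<integral> Tr (V\<^sup>2) / \<mu>\<close> decreases at the rate \<open>N\<^sup>3 exp (- N \<tau>) Q\<close>, where
  \<open>Q = \<integral> Tr (V\<^sup>2) / \<mu>\<close>, because the commutator in \<open>V\<^sub>\<tau> = U\<^sub>y + [V, U]\<close> is trace-orthogonal to \<open>V\<close>. So
  \<open>exp (- N \<tau>) Q\<close> is integrable. Pairing the wave equation with a self-adjoint section, integrating by
  parts and applying the Cauchy-Schwarz inequality bounds the squared dual norm of \<open>U\<^sub>\<tau>\<close> by
  \<open>N\<^sup>4 exp (- 2 N \<tau>) Q\<close>.
\<close>

subsection \<open>Matrices\<close>

text \<open>The form Tr (B C) is indefinite on all endomorphisms; it is an inner product only on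
  those that are self-adjoint with respect to G. This shapes both estimates. \<open>U\<close> and
  \<open>V\<close> are self-adjoint, but the plain derivative of a self-adjoint section is not, and
  the term [V, \<sigma>] / 2 in \<open>cov_deriv\<close> repairs exactly this. As that term is
  trace-orthogonal to \<open>V\<close>, it can be inserted into the paired wave equation without
  changing it, and then Cauchy-Schwarz applies.

  With t = exp (- \<tau>) one has U = - t X and U_\<tau> = t^2 (X_t + X / t). The trace of the Ricci
  equation fixes the coefficient of X in that equation to be 1 / t. This one identity says both that
  \<mu> is constant in time and that the left side is a multiple of U_\<tau> with no first-order
  remainder. The power of t in the wave equation comes from L^2 / h = N^2 t^(N - 2) / \<mu>^2, the
  squared definition of \<mu>.

  The weight exp (N \<tau>) is the one under which the squared bound on the dual norm becomes N
  times the dissipation rate of the energy.\<close>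

lemma bounded_bilinear_matrix_mult: "bounded_bilinear ((**) :: real^'n^'m \<Rightarrow> real^'k^'n \<Rightarrow> real^'k^'m)"
proof -
  have "bilinear ((**) :: real^'n^'m \<Rightarrow> real^'k^'n \<Rightarrow> real^'k^'m)"
    unfolding bilinear_def linear_iff
    by (simp add: matrix_matrix_mult_def vec_eq_iff sum.distrib sum_distrib_left algebra_simps)
  then show ?thesis
    using bilinear_conv_bounded_bilinear by blast
qed

interpretation matrix_mult: bounded_bilinear "(**) :: real^'n^'m \<Rightarrow> real^'k^'n \<Rightarrow> real^'k^'m"
  by (rule bounded_bilinear_matrix_mult)

lemma bounded_linear_trace: "bounded_linear (trace :: real^'n^'n \<Rightarrow> real)"
  by (intro linear_conv_bounded_linear[THEN iffD1])
    (simp add: linear_iff trace_def sum.distrib sum_distrib_left)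

lemmas trace_scaleR = linear_scale[OF bounded_linear.linear[OF bounded_linear_trace]]
  and trace_zero = linear_0[OF bounded_linear.linear[OF bounded_linear_trace]]

lemma bounded_linear_transpose: "bounded_linear (transpose :: real^'n^'m \<Rightarrow> real^'m^'n)"
  by (intro linear_conv_bounded_linear[THEN iffD1])
    (simp add: linear_iff transpose_def vec_eq_iff)

lemmas transpose_add = linear_add[OF bounded_linear.linear[OF bounded_linear_transpose]]
  and transpose_diff = linear_diff[OF bounded_linear.linear[OF bounded_linear_transpose]]
  and transpose_minus = linear_neg[OF bounded_linear.linear[OF bounded_linear_transpose]]

lemma matrix_inv_cancel:
  fixes M :: "real^'n^'n"
  assumes "invertible M"
  shows "M ** matrix_inv M = mat 1" "matrix_inv M ** M = mat 1"
  using someI_ex[OF assms[unfolded invertible_def]] by (auto simp: matrix_inv_def)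

lemma matrix_inv_cancel_left:
  fixes M :: "real^'n^'n"
  assumes "invertible M"
  shows "M ** (matrix_inv M ** B) = B" "matrix_inv M ** (M ** B) = B"
  using matrix_inv_cancel[OF assms] by (simp_all add: matrix_mul_assoc)

lemma matrix_inv_eqI:
  fixes M :: "real^'n^'n"
  assumes "M ** B = mat 1"
  shows "matrix_inv M = B"
proof -
  have BM: "B ** M = mat 1"
    using assms matrix_left_right_inverse by blast
  then have "invertible M"
    using assms invertible_def by blast
  then show ?thesis
    using matrix_inv_cancel_left(2)[of M B] assms by (simp add: matrix_mul_assoc[symmetric])
qed

lemma invertible_posdef:
  fixes M :: "real^'n^'n"
  assumes "\<And>v. v \<noteq> 0 \<Longrightarrow> 0 < v \<bullet> (M *v v)"
  shows "invertible M"
  unfolding invertible_left_inverse matrix_left_invertible_ker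
  by (metis assms inner_zero_right order_less_irrefl)

lemma transpose_matrix_inv:
  fixes M :: "real^'n^'n"
  assumes "invertible M"
  shows "transpose (matrix_inv M) = matrix_inv (transpose M)"
  by (rule matrix_inv_eqI[symmetric])
    (metis assms matrix_inv_cancel(2) matrix_transpose_mul transpose_mat)

lemma trace_conj:
  fixes A B :: "real^'n^'n"
  assumes "invertible A"
  shows "trace (matrix_inv A ** B ** A) = trace B"
  using assms by (metis matrix_inv_cancel_left(1) matrix_mul_assoc trace_mul_sym)

lemma tendsto_det:
  fixes f :: "'a \<Rightarrow> real^'n^'n"
  assumes "(f \<longlongrightarrow> M) F"
  shows "((\<lambda>x. det (f x)) \<longlongrightarrow> det M) F"
  unfolding det_def by (intro tendsto_intros assms)

text \<open>Cramer's rule, column by column. It exhibits the inverse as a rational function of the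
  entries, from which its continuity is read off.\<close>

lemma matrix_inv_cofactor:
  fixes M :: "real^'n^'n"
  assumes "det M \<noteq> 0"
  shows "matrix_inv M =
    (\<chi> k j. det (\<chi> i l. if l = k then (axis j 1 :: real^'n) $ i else M $ i $ l) / det M)"
proof -
  have inv: "invertible M"
    using assms invertible_det_nz by blast
  have "column j (matrix_inv M) = (\<chi> k. det (\<chi> i l. if l = k then (axis j 1 :: real^'n) $ i else M $ i $ l) / det M)" for j
  proof -
    have "M *v (matrix_inv M *v axis j 1) = axis j 1"
      using matrix_inv_cancel(1)[OF inv] by (simp add: matrix_vector_mul_assoc)
    then show ?thesis
      using cramer[OF assms] by (simp add: matrix_vector_mul_assoc matrix_vector_mult_basis)
  qed
  then show ?thesis
    by (simp add: column_def vec_eq_iff)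
qed

lemma tendsto_matrix_inv:
  fixes f :: "'a \<Rightarrow> real^'n^'n"
  assumes f: "(f \<longlongrightarrow> M) F" and "invertible M"
  shows "((\<lambda>x. matrix_inv (f x)) \<longlongrightarrow> matrix_inv M) F"
proof -
  have M: "det M \<noteq> 0"
    using assms invertible_det_nz by blast
  have det: "((\<lambda>x. det (f x)) \<longlongrightarrow> det M) F"
    by (rule tendsto_det[OF f])
  then have ev: "\<forall>\<^sub>F x in F. det (f x) \<noteq> 0"
    by (rule tendsto_imp_eventually_ne[OF _ M])
  have "((\<lambda>x. \<chi> k j. det (\<chi> i l. if l = k then (axis j 1 :: real^'n) $ i else f x $ i $ l) / det (f x))
    \<longlongrightarrow> matrix_inv M) F"
    unfolding matrix_inv_cofactor[OF M]
    apply (intro tendsto_intros tendsto_det det M)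
    subgoal for k j i l by (cases "l = k") (auto intro!: tendsto_intros f)
    apply (rule f)
    done
  then show ?thesis
    by (rule Lim_transform_eventually) (use ev in \<open>auto elim!: eventually_mono simp: matrix_inv_cofactor\<close>)
qed

lemma continuous_on_matrix_inv:
  fixes f :: "'a::topological_space \<Rightarrow> real^'n^'n"
  assumes "continuous_on S f" "\<And>x. x \<in> S \<Longrightarrow> invertible (f x)"
  shows "continuous_on S (\<lambda>x. matrix_inv (f x))"
  using assms unfolding continuous_on_def by (auto intro!: tendsto_matrix_inv)

text \<open>Where one factor vanishes, the product rule asks only for continuity of the other. This
  avoids a circle for the matrix inverse, which is known to be continuous before it is known to be
  differentiable.\<close>

lemma (in bounded_bilinear) has_derivative_vanishing_factor:
  assumes f: "(f \<longlongrightarrow> f x) (at x within S)"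
    and g: "(g has_derivative g') (at x within S)" and "g x = 0"
  shows "((\<lambda>y. prod (f y) (g y)) has_derivative (\<lambda>v. prod (f x) (g' v))) (at x within S)"
  unfolding has_derivative_iff_norm
proof (intro conjI)
  have "bounded_linear g'"
    using g by (simp add: has_derivative_bounded_linear)
  then show "bounded_linear (\<lambda>v. prod (f x) (g' v))"
    using bounded_linear_compose[OF bounded_linear_right] by blast
  obtain K where K: "\<And>a b. norm (prod a b) \<le> norm a * norm b * K" and "K > 0"
    using pos_bounded by blast
  obtain C where C: "\<And>v. norm (g' v) \<le> norm v * C" and "C > 0"
    using bounded_linear.pos_bounded[OF \<open>bounded_linear g'\<close>] by blast
  define R where "R y = norm (g y - g x - g' (y - x)) / norm (y - x)" for y
  have R: "(R \<longlongrightarrow> 0) (at x within S)"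
    using g unfolding R_def[abs_def] has_derivative_iff_norm by blast
  have lim: "((\<lambda>y. norm (f y) * R y * K + norm (f y - f x) * C * K) \<longlongrightarrow> norm (f x) * 0 * K + norm (f x - f x) * C * K) (at x within S)"
    by (intro tendsto_intros f R)
  show "((\<lambda>y. norm (prod (f y) (g y) - prod (f x) (g x) - prod (f x) (g' (y - x))) / norm (y - x)) \<longlongrightarrow> 0) (at x within S)"
  proof (rule Lim_null_comparison)
    show "((\<lambda>y. norm (f y) * R y * K + norm (f y - f x) * C * K) \<longlongrightarrow> 0) (at x within S)"
      using lim by simp
    show "\<forall>\<^sub>F y in at x within S. norm (norm (prod (f y) (g y) - prod (f x) (g x) - prod (f x) (g' (y - x))) / norm (y - x))
        \<le> norm (f y) * R y * K + norm (f y - f x) * C * K"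
      unfolding eventually_at_filter
    proof (intro always_eventually allI impI)
      fix y assume "y \<noteq> x"
      have "prod (f y) (g y) - prod (f x) (g x) - prod (f x) (g' (y - x))
        = prod (f y) (g y - g x - g' (y - x)) + prod (f y - f x) (g' (y - x))"
        by (simp add: \<open>g x = 0\<close> diff_left diff_right zero_right)
      then have "norm (prod (f y) (g y) - prod (f x) (g x) - prod (f x) (g' (y - x)))
        \<le> norm (f y) * norm (g y - g x - g' (y - x)) * K + norm (f y - f x) * norm (g' (y - x)) * K"
        using K norm_triangle_mono by metis
      also have "\<dots> \<le> norm (f y) * norm (g y - g x - g' (y - x)) * K + norm (f y - f x) * (norm (y - x) * C) * K"
        using C \<open>K > 0\<close> by (intro add_left_mono mult_right_mono mult_left_mono) auto
      finally show "norm (norm (prod (f y) (g y) - prod (f x) (g x) - prod (f x) (g' (y - x))) / norm (y - x))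
        \<le> norm (f y) * R y * K + norm (f y - f x) * C * K"
        using \<open>y \<noteq> x\<close> by (simp add: R_def field_simps)
    qed
  qed
qed

text \<open>The identity f(y)^-1 = f(x)^-1 - f(y)^-1 (f(y) - f(x)) f(x)^-1 isolates a factor that
  vanishes at x, so continuity of the inverse is enough to differentiate the product.\<close>

lemma has_derivative_matrix_inv:
  fixes f :: "'a::real_normed_vector \<Rightarrow> real^'n^'n"
  assumes f: "(f has_derivative f') (at x within S)" and x: "x \<in> S"
    and inv: "\<And>y. y \<in> S \<Longrightarrow> invertible (f y)"
  shows "((\<lambda>y. matrix_inv (f y)) has_derivative (\<lambda>v. - (matrix_inv (f x) ** f' v ** matrix_inv (f x)))) (at x within S)"
proof -
  have cont: "((\<lambda>y. matrix_inv (f y)) \<longlongrightarrow> matrix_inv (f x)) (at x within S)"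
    using has_derivative_continuous[OF f] inv[OF x] unfolding continuous_within
    by (rule tendsto_matrix_inv)
  have "((\<lambda>y. (f y - f x) ** matrix_inv (f x)) has_derivative (\<lambda>v. f' v ** matrix_inv (f x))) (at x within S)"
    by (auto intro!: derivative_eq_intros f bounded_linear.has_derivative[OF matrix_mult.bounded_linear_left])
  then have "((\<lambda>y. matrix_inv (f y) ** ((f y - f x) ** matrix_inv (f x))) has_derivative
      (\<lambda>v. matrix_inv (f x) ** (f' v ** matrix_inv (f x)))) (at x within S)"
    by (intro matrix_mult.has_derivative_vanishing_factor[OF cont]) (auto simp: matrix_mult.zero_left)
  then have "((\<lambda>y. matrix_inv (f x) - matrix_inv (f y) ** ((f y - f x) ** matrix_inv (f x))) has_derivative
      (\<lambda>v. - (matrix_inv (f x) ** f' v ** matrix_inv (f x)))) (at x within S)"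
    by (auto intro!: derivative_eq_intros simp: matrix_mul_assoc)
  then show ?thesis
  proof (rule has_derivative_transform[OF x, rotated])
    fix y assume "y \<in> S"
    then show "matrix_inv (f y) = matrix_inv (f x) - matrix_inv (f y) ** ((f y - f x) ** matrix_inv (f x))"
      using inv x by (simp add: matrix_mult.diff_left matrix_mult.diff_right matrix_inv_cancel matrix_inv_cancel_left)
  qed
qed

lemma has_vector_derivative_matrix_inv:
  fixes f :: "real \<Rightarrow> real^'n^'n"
  assumes "(f has_vector_derivative f') (at x within S)" "x \<in> S" "\<And>y. y \<in> S \<Longrightarrow> invertible (f y)"
  shows "((\<lambda>y. matrix_inv (f y)) has_vector_derivative - (matrix_inv (f x) ** f' ** matrix_inv (f x))) (at x within S)"
  using has_derivative_matrix_inv[OF assms[unfolded has_vector_derivative_def]]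
  by (simp add: has_vector_derivative_def matrix_mult.scaleR_left matrix_mult.scaleR_right)

lemma permutes_UNIV_eq_id:
  assumes "p permutes (UNIV :: 'n set)" "\<And>j. j \<noteq> i \<Longrightarrow> p j = j"
  shows "p = id"
proof
  fix j
  have "p i = i"
    using assms permutes_inj[OF assms(1)] by (metis injD)
  then show "p j = id j"
    using assms(2) by (cases "j = i") auto
qed

lemma has_real_derivative_det_at_mat_1:
  fixes f :: "real \<Rightarrow> real^'n^'n"
  assumes f: "(f has_vector_derivative f') (at x within S)" and 1: "f x = mat 1"
  shows "((\<lambda>y. det (f y)) has_real_derivative trace f') (at x within S)"
proof -
  have comp: "((\<lambda>y. f y $ i $ j) has_derivative (\<lambda>v. v * (f' $ i $ j))) (at x within S)" for i j
    using bounded_linear.has_derivative[OF bounded_linear_vec_nth[of j] bounded_linear.has_derivative[OF bounded_linear_vec_nth[of i] f[unfolded has_vector_derivative_def]]]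
    by simp
  let ?D = "\<lambda>p v. \<Sum>i\<in>UNIV. v * (f' $ i $ p i) * (\<Prod>j\<in>UNIV - {i}. f x $ j $ p j)"
  \<comment> \<open>A permutation other than the identity moves at least two points, so even with
    row i left out some off-diagonal entry of the identity matrix remains as a factor.\<close>
  have prod0: "(\<Prod>j\<in>UNIV - {i}. f x $ j $ p j) = 0" if "p permutes UNIV" "p \<noteq> id" for p and i :: 'n
  proof -
    have "\<exists>j. j \<noteq> i \<and> p j \<noteq> j"
      using that permutes_UNIV_eq_id[of p i] by auto
    then obtain j where "j \<noteq> i" "p j \<noteq> j" by blast
    then show ?thesis
      by (intro prod_zero bexI[of _ j]) (auto simp: 1 mat_def)
  qed
  have "((\<lambda>y. det (f y)) has_derivative (\<lambda>v. \<Sum>p | p permutes UNIV. of_int (sign p) * ?D p v)) (at x within S)"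
    unfolding det_def by (intro has_derivative_sum has_derivative_mult_right has_derivative_prod comp)
  moreover have "(\<Sum>p | p permutes (UNIV :: 'n set). of_int (sign p) * ?D p v) = trace f' * v" for v
  proof -
    have "(\<Sum>p | p permutes (UNIV :: 'n set). of_int (sign p) * ?D p v) = (\<Sum>p\<in>{id}. of_int (sign p) * ?D p v)"
      by (rule sum.mono_neutral_right) (auto simp: prod0 permutes_id finite_permutations)
    also have "\<dots> = trace f' * v"
      by (simp add: 1 mat_def sign_id trace_def sum_distrib_left mult.commute)
    finally show ?thesis .
  qed
  ultimately show ?thesis
    by (simp add: has_field_derivative_def)
qed

text \<open>Jacobi's formula, reduced to the identity matrix by factoring \<open>det (f x)\<close>
  out of \<open>det (f y)\<close>.\<close>

lemma has_real_derivative_det: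
  fixes f :: "real \<Rightarrow> real^'n^'n"
  assumes f: "(f has_vector_derivative f') (at x within S)" and inv: "invertible (f x)"
  shows "((\<lambda>y. det (f y)) has_real_derivative det (f x) * trace (matrix_inv (f x) ** f')) (at x within S)"
proof -
  have "((\<lambda>y. matrix_inv (f x) ** f y) has_vector_derivative matrix_inv (f x) ** f') (at x within S)"
    using bounded_linear.has_vector_derivative[OF matrix_mult.bounded_linear_right f] .
  then have "((\<lambda>y. det (matrix_inv (f x) ** f y)) has_real_derivative trace (matrix_inv (f x) ** f')) (at x within S)"
    by (rule has_real_derivative_det_at_mat_1) (simp add: matrix_inv_cancel inv)
  then have "((\<lambda>y. det (f x) * det (matrix_inv (f x) ** f y)) has_real_derivative det (f x) * trace (matrix_inv (f x) ** f')) (at x within S)"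
    by (rule DERIV_cmult)
  moreover have "det (f x) * det (matrix_inv (f x) ** f y) = det (f y)" for y
    using matrix_inv_cancel_left(1)[OF inv] by (metis det_mul)
  ultimately show ?thesis
    by simp
qed

text \<open>The source of Cauchy-Schwarz, both for matrices and for integrals of traces. The case c
  = 0 is included because the forms in question are only known to be semidefinite.\<close>

lemma quadratic_nonneg_discriminant:
  fixes a b c :: real
  assumes "\<And>s. 0 \<le> a + 2 * s * b + s\<^sup>2 * c"
  shows "b\<^sup>2 \<le> a * c"
proof (cases "c = 0")
  case True
  have "b = 0"
  proof (rule ccontr)
    assume "b \<noteq> 0"
    \<comment> \<open>At this s the polynomial, affine because c = 0, has the value -1.\<close>
    then show False
      using assms[of "- (a + 1) / (2 * b)"] True by (simp add: field_simps)
  qed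
  then show ?thesis by (simp add: True)
next
  case False
  have "c \<ge> 0"
  proof (rule ccontr)
    assume "\<not> c \<ge> 0"
    \<comment> \<open>Large enough that s c <= - (|a| + 2 |b| + 1); together with s >= 1 this pushes
      the quadratic down to at most - s.\<close>
    define s where "s = (\<bar>a\<bar> + 2 * \<bar>b\<bar> + 1) / (- c) + 1"
    have "c < 0" using \<open>\<not> c \<ge> 0\<close> by simp
    have s1: "s \<ge> 1" unfolding s_def using \<open>c < 0\<close> by (simp add: divide_nonneg_neg)
    have sc: "s * c = c - (\<bar>a\<bar> + 2 * \<bar>b\<bar> + 1)"
      unfolding s_def using \<open>c < 0\<close> by (simp add: field_simps)
    have "s\<^sup>2 * c = s * (s * c)" by (simp add: power2_eq_square)
    also have "\<dots> \<le> s * (- (\<bar>a\<bar> + 2 * \<bar>b\<bar> + 1))"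
      using sc s1 \<open>c < 0\<close> by (intro mult_left_mono) auto
    finally have "a + 2 * s * b + s\<^sup>2 * c \<le> a + 2 * s * b - s * (\<bar>a\<bar> + 2 * \<bar>b\<bar> + 1)" by (simp add: algebra_simps)
    also have "\<dots> \<le> s * \<bar>a\<bar> + 2 * s * \<bar>b\<bar> - s * (\<bar>a\<bar> + 2 * \<bar>b\<bar> + 1)"
    proof -
      have "a \<le> s * \<bar>a\<bar>" using s1 mult_right_mono[of 1 s "\<bar>a\<bar>"] by linarith
      moreover have "s * b \<le> s * \<bar>b\<bar>" using s1 by (intro mult_left_mono) auto
      ultimately show ?thesis by linarith
    qed
    also have "\<dots> < 0" using s1 by (simp add: algebra_simps)
    finally show False using assms[of s] by simp
  qed
  then have "c > 0" using False by simp
  have "0 \<le> a + 2 * (- b / c) * b + (- b / c)\<^sup>2 * c" by (rule assms)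
  then have "0 \<le> a - b\<^sup>2 / c"
    using \<open>c > 0\<close> by (simp add: power2_eq_square field_simps)
  then show ?thesis
    using \<open>c > 0\<close> by (simp add: field_simps)
qed

lemma psd_Cauchy_Schwarz:
  fixes H :: "real^'n^'n"
  assumes sym: "transpose H = H" and psd: "\<And>v. 0 \<le> v \<bullet> (H *v v)"
  shows "(v \<bullet> (H *v w))\<^sup>2 \<le> (v \<bullet> (H *v v)) * (w \<bullet> (H *v w))"
proof (rule quadratic_nonneg_discriminant)
  fix s
  have "w \<bullet> (H *v v) = v \<bullet> (H *v w)"
    by (metis dot_lmul_matrix inner_commute sym vector_transpose_matrix)
  then show "0 \<le> v \<bullet> (H *v v) + 2 * s * (v \<bullet> (H *v w)) + s\<^sup>2 * (w \<bullet> (H *v w))"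
    using psd[of "v + s *\<^sub>R w"]
    by (simp add: matrix_vector_right_distrib matrix_vector_mult_scaleR inner_add_left inner_add_right power2_eq_square algebra_simps)
qed

text \<open>Peeling rank-one forms off \<open>H\<close> replaces its Cholesky decomposition.\<close>

lemma trace_psd_mult_nonneg:
  fixes H B :: "real^'n^'n"
  assumes "transpose H = H" "\<And>v. 0 \<le> v \<bullet> (H *v v)" and B: "\<And>v. 0 \<le> v \<bullet> (B *v v)"
  shows "0 \<le> trace (H ** B)"
  using assms(1,2)
\<comment> \<open>By Cauchy-Schwarz a zero diagonal entry forces its whole row and column to vanish,
  so the count is 0 only for H = 0.\<close>
proof (induction "card {i. H $ i $ i \<noteq> 0}" arbitrary: H rule: less_induct)
  case less
  note sym = less.prems(1) and psd = less.prems(2)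
  have entry: "axis i 1 \<bullet> (M *v axis j 1) = M $ i $ j" for i j and M :: "real^'n^'n"
    by (simp add: matrix_vector_mult_basis column_def inner_axis')
  have symH: "H $ i $ j = H $ j $ i" for i j
    using sym by (metis (no_types) transpose_def vec_lambda_beta)
  have CS: "(H $ i $ j)\<^sup>2 \<le> H $ i $ i * H $ j $ j" for i j
    using psd_Cauchy_Schwarz[OF sym psd, of "axis i 1" "axis j 1"] by (simp add: entry)
  show ?case
  proof (cases "\<exists>e. H $ e $ e \<noteq> 0")
    case False
    then have "H $ i $ j = 0" for i j
      using CS[of i j] by simp
    then have "H = 0"
      by (simp add: vec_eq_iff)
    then show ?thesis
      by (simp add: matrix_mult.zero_left trace_zero)
  next
    case True
    then obtain e where e: "H $ e $ e \<noteq> 0" by blast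
    define d where "d = H $ e $ e"
    have d: "d > 0"
      using psd[of "axis e 1"] e by (simp add: entry d_def)
    \<comment> \<open>R = w w^T / d agrees with H in row and column e, so H - R has a zero there.
      Cauchy-Schwarz against the basis vector e says that H - R is still semidefinite, and diagonal
      entries that were zero stay zero.\<close>
    define w where "w = column e H"
    have w: "w $ i = H $ i $ e" for i by (simp add: w_def column_def)
    define R where "R = (\<chi> i j. w $ i * w $ j / d)"
    have R: "v \<bullet> (R *v v') = (v \<bullet> w) * (w \<bullet> v') / d" for v v'
      by (simp add: R_def inner_vec_def matrix_vector_mult_def sum_product sum_distrib_left sum_distrib_right sum_divide_distrib mult_ac)
    have "0 \<le> trace ((H - R) ** B)"
    proof (rule less.hyps)
      show "transpose (H - R) = H - R"
        using symH by (simp add: transpose_def vec_eq_iff R_def mult.commute)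
      show "0 \<le> v \<bullet> ((H - R) *v v)" for v
      proof -
        have "(v \<bullet> w)\<^sup>2 \<le> (v \<bullet> (H *v v)) * d"
          using psd_Cauchy_Schwarz[OF sym psd, of v "axis e 1"]
          unfolding entry by (simp add: d_def w_def matrix_vector_mult_basis)
        then show ?thesis
          using d by (simp add: matrix_vector_mult_diff_rdistrib inner_diff_right R power2_eq_square inner_commute[of w] field_simps)
      qed
      have "{i. (H - R) $ i $ i \<noteq> 0} \<subseteq> {i. H $ i $ i \<noteq> 0} - {e}"
      proof
        fix i assume "i \<in> {i. (H - R) $ i $ i \<noteq> 0}"
        then have i: "H $ i $ i \<noteq> w $ i * w $ i / d" by (simp add: R_def)
        have "w $ i = 0" if "H $ i $ i = 0"
          using CS[of i e] that by (simp add: w)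
        then show "i \<in> {i. H $ i $ i \<noteq> 0} - {e}"
          using i d by (auto simp: w d_def)
      qed
      then show "card {i. (H - R) $ i $ i \<noteq> 0} < card {i. H $ i $ i \<noteq> 0}"
        using e by (intro psubset_card_mono) auto
    qed
    moreover have "trace (R ** B) = w \<bullet> (B *v w) / d"
    proof -
      have "trace (R ** B) = (\<Sum>i\<in>UNIV. \<Sum>k\<in>UNIV. w $ i * w $ k * B $ k $ i / d)"
        by (simp add: trace_def matrix_matrix_mult_def R_def)
      also have "\<dots> = (\<Sum>k\<in>UNIV. \<Sum>i\<in>UNIV. w $ i * w $ k * B $ k $ i / d)"
        by (rule sum.swap)
      also have "\<dots> = w \<bullet> (B *v w) / d"
        by (simp add: inner_vec_def matrix_vector_mult_def sum_distrib_left sum_divide_distrib mult_ac)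
      finally show ?thesis .
    qed
    moreover have "trace (H ** B) = trace ((H - R) ** B) + trace (R ** B)"
      by (simp add: matrix_mult.diff_left trace_sub)
    ultimately show ?thesis
      using B[of w] d by simp
  qed
qed

lemma psd_matrix_inv:
  fixes g :: "real^'n^'n"
  assumes "\<And>v. v \<noteq> 0 \<Longrightarrow> 0 < v \<bullet> (g *v v)"
  shows "0 \<le> v \<bullet> (matrix_inv g *v v)"
proof -
  have "v = g *v (matrix_inv g *v v)"
    by (simp add: matrix_vector_mul_assoc matrix_inv_cancel[OF invertible_posdef[OF assms]])
  then have "v \<bullet> (matrix_inv g *v v) = (matrix_inv g *v v) \<bullet> (g *v (matrix_inv g *v v))"
    by (metis inner_commute)
  then show ?thesis
    using assms[of "matrix_inv g *v v"] by (cases "matrix_inv g *v v = 0") auto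
qed

text \<open>Symmetry of g S and of g gives S^T g = g S, hence S S = g^-1 (S^T g S). This is a
  product of two positive semidefinite matrices, so its trace is nonnegative.\<close>

lemma trace_square_self_adjoint_nonneg:
  fixes g S :: "real^'n^'n"
  assumes sym: "transpose g = g" and pos: "\<And>v. v \<noteq> 0 \<Longrightarrow> 0 < v \<bullet> (g *v v)"
    and S: "transpose (g ** S) = g ** S"
  shows "0 \<le> trace (S ** S)"
proof -
  let ?h = "matrix_inv g"
  have inv: "invertible g" by (rule invertible_posdef[OF pos])
  have "0 \<le> trace (?h ** (transpose S ** g ** S))"
  proof (rule trace_psd_mult_nonneg)
    show "transpose ?h = ?h"
      by (simp add: transpose_matrix_inv inv sym)
    show "0 \<le> v \<bullet> (?h *v v)" for v
      by (rule psd_matrix_inv[OF pos])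
    show "0 \<le> v \<bullet> ((transpose S ** g ** S) *v v)" for v
    proof -
      have "v \<bullet> ((transpose S ** g ** S) *v v) = (S *v v) \<bullet> (g *v (S *v v))"
        by (metis dot_lmul_matrix matrix_vector_mul_assoc vector_transpose_matrix)
      then show ?thesis
        using pos[of "S *v v"] by (cases "S *v v = 0") auto
    qed
  qed
  also have "transpose S ** g ** S = g ** S ** S"
    using S by (simp add: matrix_transpose_mul sym)
  also have "?h ** (g ** S ** S) = S ** S"
    using matrix_inv_cancel_left(2)[OF inv] by (metis matrix_mul_assoc)
  finally show ?thesis .
qed

subsection \<open>Functions of class \<open>C\<^sup>k\<close>\<close>

lemma Ck_on_SucI:
  assumes "\<And>x. x \<in> S \<Longrightarrow> (f has_derivative f' x) (at x within S)" "\<And>v. Ck_on k S (\<lambda>x. f' x v)"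
  shows "Ck_on (Suc k) S f"
  using assms by auto

lemma Ck_on_SucE:
  assumes "Ck_on (Suc k) S f"
  obtains f' where "\<And>x. x \<in> S \<Longrightarrow> (f has_derivative f' x) (at x within S)" "\<And>v. Ck_on k S (\<lambda>x. f' x v)"
  using assms by auto

lemma Ck_on_imp_continuous_on: "Ck_on k S f \<Longrightarrow> continuous_on S f"
  by (cases k) (auto simp: continuous_on_eq_continuous_within intro: has_derivative_continuous)

lemma Ck_on_SucD: "Ck_on (Suc k) S f \<Longrightarrow> Ck_on k S f"
proof (induction k arbitrary: f)
  case 0
  then show ?case by (metis Ck_on.simps(1) Ck_on_imp_continuous_on)
next
  case (Suc k)
  from Suc.prems obtain f' where "\<And>x. x \<in> S \<Longrightarrow> (f has_derivative f' x) (at x within S)"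
    "\<And>v. Ck_on (Suc k) S (\<lambda>x. f' x v)" by (rule Ck_on_SucE) blast
  then show ?case by (auto intro!: Suc.IH Ck_on_SucI[of S f f' k] simp del: Ck_on.simps)
qed

lemma Ck_on_bounded_linear:
  assumes "bounded_linear h" "Ck_on k S f"
  shows "Ck_on k S (\<lambda>x. h (f x))"
  using assms(2)
proof (induction k arbitrary: f)
  case 0
  then show ?case
    using bounded_linear.continuous_on[OF assms(1)] by simp
next
  case (Suc k)
  from Suc.prems obtain f' where "\<And>x. x \<in> S \<Longrightarrow> (f has_derivative f' x) (at x within S)"
    "\<And>v. Ck_on k S (\<lambda>x. f' x v)" by (rule Ck_on_SucE) blast
  then show ?case
    by (intro Ck_on_SucI[where f'="\<lambda>x v. h (f' x v)"] Suc.IH bounded_linear.has_derivative[OF assms(1)])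
qed

lemma Ck_on_add:
  assumes "Ck_on k S f" "Ck_on k S g"
  shows "Ck_on k S (\<lambda>x. f x + g x)"
  using assms
proof (induction k arbitrary: f g)
  case 0
  then show ?case by (simp add: continuous_on_add)
next
  case (Suc k)
  from Suc.prems(1) obtain f' where f: "\<And>x. x \<in> S \<Longrightarrow> (f has_derivative f' x) (at x within S)"
    "\<And>v. Ck_on k S (\<lambda>x. f' x v)" by (rule Ck_on_SucE) blast
  from Suc.prems(2) obtain g' where g: "\<And>x. x \<in> S \<Longrightarrow> (g has_derivative g' x) (at x within S)"
    "\<And>v. Ck_on k S (\<lambda>x. g' x v)" by (rule Ck_on_SucE) blast
  show ?case
    by (intro Ck_on_SucI[where f'="\<lambda>x v. f' x v + g' x v"] Suc.IH has_derivative_add f g)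
qed

lemma (in bounded_bilinear) Ck_on:
  assumes "Ck_on k S f" "Ck_on k S g"
  shows "Ck_on k S (\<lambda>x. prod (f x) (g x))"
  using assms
proof (induction k arbitrary: f g)
  case 0
  then show ?case by (simp add: continuous_on)
next
  case (Suc k)
  from Suc.prems(1) obtain f' where f: "\<And>x. x \<in> S \<Longrightarrow> (f has_derivative f' x) (at x within S)"
    "\<And>v. Ck_on k S (\<lambda>x. f' x v)" by (rule Ck_on_SucE) blast
  from Suc.prems(2) obtain g' where g: "\<And>x. x \<in> S \<Longrightarrow> (g has_derivative g' x) (at x within S)"
    "\<And>v. Ck_on k S (\<lambda>x. g' x v)" by (rule Ck_on_SucE) blast
  show ?case
    by (intro Ck_on_SucI[where f'="\<lambda>x v. prod (f x) (g' x v) + prod (f' x v) (g x)"]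
        Suc.IH FDERIV f g Ck_on_add Suc.prems[THEN Ck_on_SucD])
qed

text \<open>A bootstrap: the derivative of the inverse is a product of the derivative of f with the
  inverse itself, whose regularity of one order less is the induction hypothesis.\<close>

lemma Ck_on_matrix_inv:
  fixes f :: "'a::real_normed_vector \<Rightarrow> real^'n^'n"
  assumes "Ck_on k S f" and inv: "\<And>x. x \<in> S \<Longrightarrow> invertible (f x)"
  shows "Ck_on k S (\<lambda>x. matrix_inv (f x))"
  using assms(1)
proof (induction k)
  case 0
  then show ?case by (simp add: continuous_on_matrix_inv inv)
next
  case (Suc k)
  from Suc.prems(1) obtain f' where f: "\<And>x. x \<in> S \<Longrightarrow> (f has_derivative f' x) (at x within S)"
    "\<And>v. Ck_on k S (\<lambda>x. f' x v)" by (rule Ck_on_SucE) blast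
  have "Ck_on k S (\<lambda>x. matrix_inv (f x))"
    using Suc Ck_on_SucD by blast
  then show ?case
    by (intro Ck_on_SucI[where f'="\<lambda>x v. - (matrix_inv (f x) ** f' x v ** matrix_inv (f x))"]
        has_derivative_matrix_inv f inv Ck_on_bounded_linear[OF bounded_linear_minus[OF bounded_linear_ident]] matrix_mult.Ck_on)
qed

section \<open>Partial derivatives on strips\<close>

lemma has_derivative_slice_fst:
  assumes "(f has_derivative f') (at (t, y) within T \<times> Y)" "y \<in> Y"
  shows "((\<lambda>s. f (s, y)) has_derivative (\<lambda>v. f' (v, 0))) (at t within T)"
  by (rule has_derivative_in_compose[of "\<lambda>s. (s, y)"])
    (use assms in \<open>auto intro!: derivative_eq_intros has_derivative_subset[OF assms(1)]\<close>)

lemma has_derivative_slice_snd: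
  assumes "(f has_derivative f') (at (t, y) within T \<times> Y)" "t \<in> T"
  shows "((\<lambda>z. f (t, z)) has_derivative (\<lambda>v. f' (0, v))) (at y within Y)"
  by (rule has_derivative_in_compose[of "\<lambda>s. (t, s)"])
    (use assms in \<open>auto intro!: derivative_eq_intros has_derivative_subset[OF assms(1)]\<close>)

lemma Ck_on_slice_snd:
  assumes "Ck_on k (T \<times> Y) f" "t \<in> T"
  shows "Ck_on k Y (\<lambda>y. f (t, y))"
  using assms(1)
proof (induction k arbitrary: f)
  case 0
  then show ?case
    using assms(2) by (auto intro!: continuous_on_compose2[of "T \<times> Y" f] continuous_intros)
next
  case (Suc k)
  from Suc.prems(1) obtain f' where f: "\<And>x. x \<in> T \<times> Y \<Longrightarrow> (f has_derivative f' x) (at x within T \<times> Y)"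
    "\<And>v. Ck_on k (T \<times> Y) (\<lambda>x. f' x v)" by (rule Ck_on_SucE) blast
  show ?case
    by (rule Ck_on_SucI[where f'="\<lambda>y v. f' (t, y) (0, v)"])
      (use f(1) assms(2) Suc.IH[OF f(2)] in \<open>auto intro!: has_derivative_slice_snd\<close>)
qed

lemma Ck_on_partials:
  fixes f :: "real \<Rightarrow> real \<Rightarrow> 'b::real_normed_vector"
  assumes "Ck_on (Suc k) (T \<times> UNIV) (\<lambda>(t, y). f t y)"
  obtains ft fy where
    "Ck_on k (T \<times> UNIV) (\<lambda>(t, y). ft t y)" "Ck_on k (T \<times> UNIV) (\<lambda>(t, y). fy t y)"
    "\<And>t y. t \<in> T \<Longrightarrow> ((\<lambda>s. f s y) has_vector_derivative ft t y) (at t within T)"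
    "\<And>t y. t \<in> T \<Longrightarrow> (f t has_vector_derivative fy t y) (at y)"
proof -
  from assms obtain f' where f: "\<And>x. x \<in> T \<times> UNIV \<Longrightarrow> ((\<lambda>(t, y). f t y) has_derivative f' x) (at x within T \<times> UNIV)"
    and Ck: "\<And>v. Ck_on k (T \<times> UNIV) (\<lambda>x. f' x v)" by (rule Ck_on_SucE) blast
  have lin: "f' (t, y) (a *\<^sub>R v) = a *\<^sub>R f' (t, y) v" if "t \<in> T" for t y a v
    using f[of "(t, y)"] that by (auto dest!: has_derivative_linear simp: linear_scale)
  show ?thesis
  proof (rule that[of "\<lambda>t y. f' (t, y) (1, 0)" "\<lambda>t y. f' (t, y) (0, 1)"])
    show "((\<lambda>s. f s y) has_vector_derivative f' (t, y) (1, 0)) (at t within T)" if "t \<in> T" for t y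
    proof -
      have "(\<lambda>v. f' (t, y) (v, 0)) = (\<lambda>v. v *\<^sub>R f' (t, y) (1, 0))"
        by (rule ext) (simp add: lin[OF that, symmetric])
      then show ?thesis
        using has_derivative_slice_fst[OF f, of t y] that by (simp add: has_vector_derivative_def)
    qed
    show "(f t has_vector_derivative f' (t, y) (0, 1)) (at y)" if "t \<in> T" for t y
    proof -
      have "(\<lambda>v. f' (t, y) (0, v)) = (\<lambda>v. v *\<^sub>R f' (t, y) (0, 1))"
        by (rule ext) (simp add: lin[OF that, symmetric])
      then show ?thesis
        using has_derivative_slice_snd[OF f, of t y] that by (simp add: has_vector_derivative_def)
    qed
  qed (use Ck[of "(1, 0)"] Ck[of "(0, 1)"] in \<open>simp_all add: case_prod_unfold\<close>)
qed

lemma smooth_on_deriv: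
  assumes "smooth_on UNIV (\<sigma> :: real \<Rightarrow> 'b::real_normed_vector)"
  obtains \<sigma>' where "\<And>y. (\<sigma> has_vector_derivative \<sigma>' y) (at y)" "continuous_on UNIV \<sigma>'"
proof -
  have "Ck_on (Suc 0) UNIV \<sigma>"
    using assms smooth_on_def by blast
  then obtain \<sigma>' where d: "\<And>x. x \<in> UNIV \<Longrightarrow> (\<sigma> has_derivative \<sigma>' x) (at x within UNIV)"
    and c: "\<And>v. Ck_on 0 UNIV (\<lambda>x. \<sigma>' x v)"
    by (rule Ck_on_SucE) blast
  have "(\<lambda>v. v *\<^sub>R \<sigma>' y 1) = \<sigma>' y" for y
  proof
    fix v
    show "v *\<^sub>R \<sigma>' y 1 = \<sigma>' y v"
      using linear_scale[OF has_derivative_linear[OF d], of y v 1] by simp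
  qed
  then show ?thesis
    using that[of "\<lambda>y. \<sigma>' y 1"] d c by (simp add: has_vector_derivative_def)
qed

text \<open>Differentiating f(s, z) = f(a, z) + (integral of ft over [a, s]) under the integral
  gives fy(s, y) = fy(a, y) + (integral of fty over [a, s]), and the fundamental theorem then
  identifies the t-derivative of fy. The argument reaches the end points, where t-derivatives are
  one-sided.\<close>

lemma mixed_partials_Icc:
  fixes f ft fy fty fyt :: "real \<Rightarrow> real \<Rightarrow> 'b::banach"
  assumes ft: "\<And>t y. t \<in> {a..b} \<Longrightarrow> ((\<lambda>s. f s y) has_vector_derivative ft t y) (at t within {a..b})"
    and fy: "\<And>t y. t \<in> {a..b} \<Longrightarrow> (f t has_vector_derivative fy t y) (at y)"
    and fty: "\<And>t y. t \<in> {a..b} \<Longrightarrow> (ft t has_vector_derivative fty t y) (at y)"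
    and fyt: "\<And>t y. t \<in> {a..b} \<Longrightarrow> ((\<lambda>s. fy s y) has_vector_derivative fyt t y) (at t within {a..b})"
    and cont_ft: "continuous_on ({a..b} \<times> UNIV) (\<lambda>(t, y). ft t y)"
    and cont_fty: "continuous_on ({a..b} \<times> UNIV) (\<lambda>(t, y). fty t y)"
    and "a < b" "t \<in> {a..b}"
  shows "fyt t y = fty t y"
proof -
  have slice: "continuous_on {a..b} (\<lambda>s. g s z)" if "continuous_on ({a..b} \<times> UNIV) (\<lambda>(t, y). g t y)"
    for g :: "real \<Rightarrow> real \<Rightarrow> 'b" and z
    using that by (intro continuous_on_compose2[OF that, of "{a..b}" "\<lambda>s. (s, z)", simplified] continuous_intros) auto
  have f_eq: "f s z = f a z + integral {a..s} (\<lambda>r. ft r z)" if "s \<in> {a..b}" for s z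
  proof -
    have "((\<lambda>r. ft r z) has_integral f s z - f a z) {a..s}"
      by (rule fundamental_theorem_of_calculus)
        (use that in \<open>auto intro: has_vector_derivative_within_subset[OF ft]\<close>)
    then show ?thesis by (simp add: integral_unique)
  qed
  have fy_eq: "fy s y = fy a y + integral {a..s} (\<lambda>r. fty r y)" if s: "s \<in> {a..b}" for s
  proof -
    have "((\<lambda>z. integral (cbox a s) (\<lambda>r. ft r z)) has_vector_derivative integral (cbox a s) (\<lambda>r. fty r y)) (at y within UNIV)"
    proof (rule leibniz_rule_vector_derivative)
      show "continuous_on (UNIV \<times> cbox a s) (\<lambda>(z, r). fty r z)"
        using s unfolding split_beta
        by (intro continuous_on_compose2[OF cont_fty, of _ "\<lambda>p. (snd p, fst p)", simplified] continuous_intros) auto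
      show "(\<lambda>r. ft r z) integrable_on cbox a s" for z
        using s by (auto intro!: integrable_continuous_interval continuous_on_subset[OF slice[OF cont_ft]])
    qed (use s in \<open>auto intro: fty\<close>)
    then have "((\<lambda>z. f a z + integral {a..s} (\<lambda>r. ft r z)) has_vector_derivative fy a y + integral {a..s} (\<lambda>r. fty r y)) (at y)"
      using \<open>a < b\<close> by (intro has_vector_derivative_add fy) auto
    then show ?thesis
      using fy[OF s, of y] f_eq[OF s] vector_derivative_unique_at by (metis (no_types, lifting) ext)
  qed
  have "((\<lambda>s. fy a y + integral {a..s} (\<lambda>r. fty r y)) has_vector_derivative 0 + fty t y) (at t within {a..b})"
    by (intro has_vector_derivative_add has_vector_derivative_const integral_has_vector_derivative slice cont_fty) fact
  then have "((\<lambda>s. fy a y + integral {a..s} (\<lambda>r. fty r y)) has_vector_derivative fty t y) (at t within {a..b})"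
    by simp
  then have "((\<lambda>s. fy s y) has_vector_derivative fty t y) (at t within {a..b})"
  proof (rule has_vector_derivative_transform[OF \<open>t \<in> {a..b}\<close>, rotated])
    show "fy s y = fy a y + integral {a..s} (\<lambda>r. fty r y)" if "s \<in> {a..b}" for s
      by (rule fy_eq[OF that])
  qed
  then show ?thesis
    using vector_derivative_unique_within_closed_interval[OF \<open>a < b\<close>, of t] fyt[OF \<open>t \<in> {a..b}\<close>] \<open>t \<in> {a..b}\<close>
    by (metis cbox_interval)
qed

subsection \<open>The wave equation: energy decay and the dual norm\<close>

text \<open>The analytic content, detached from the metric: \<open>P\<close>, \<open>U\<close>,
  \<open>V\<close>, \<open>\<eta>\<close>, \<open>Uy\<close> stand for G, G^-1 G_\<tau>, G^-1 G_y,
  U_\<tau>, U_y at t = exp (- \<tau>), and \<open>m\<close> for the coefficient of dy in \<mu>. The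
  formula for V_\<tau> records the equality of the mixed partials of G. The wave equation is put as
  a derivative of V / m, so that \<open>m\<close> may be merely continuous.\<close>

locale gowdy_wave =
  fixes A :: "real^'n::finite^'n" and \<tau>0 N :: real
    and P U V \<eta> Uy :: "real \<Rightarrow> real \<Rightarrow> real^'n^'n" and m :: "real \<Rightarrow> real"
  assumes N_pos: "0 < N"
    and invertible_A: "invertible A"
    and symmetric_P: "\<And>\<tau> y. \<tau> \<ge> \<tau>0 \<Longrightarrow> transpose (P \<tau> y) = P \<tau> y"
    and posdef_P: "\<And>\<tau> y v. \<tau> \<ge> \<tau>0 \<Longrightarrow> v \<noteq> 0 \<Longrightarrow> 0 < v \<bullet> (P \<tau> y *v v)"
    and equivariant_P: "\<And>\<tau> y. \<tau> \<ge> \<tau>0 \<Longrightarrow> P \<tau> (y + 1) = transpose A ** P \<tau> y ** A"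
    and equivariant_U: "\<And>\<tau> y. \<tau> \<ge> \<tau>0 \<Longrightarrow> U \<tau> (y + 1) = matrix_inv A ** U \<tau> y ** A"
    and equivariant_V: "\<And>\<tau> y. \<tau> \<ge> \<tau>0 \<Longrightarrow> V \<tau> (y + 1) = matrix_inv A ** V \<tau> y ** A"
    and self_adjoint_U: "\<And>\<tau> y. \<tau> \<ge> \<tau>0 \<Longrightarrow> transpose (P \<tau> y ** U \<tau> y) = P \<tau> y ** U \<tau> y"
    and self_adjoint_V: "\<And>\<tau> y. \<tau> \<ge> \<tau>0 \<Longrightarrow> transpose (P \<tau> y ** V \<tau> y) = P \<tau> y ** V \<tau> y"
    and smooth_P: "\<And>\<tau>. \<tau> \<ge> \<tau>0 \<Longrightarrow> smooth_on UNIV (P \<tau>)"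
    and P_y: "\<And>\<tau> y. \<tau> \<ge> \<tau>0 \<Longrightarrow> (P \<tau> has_vector_derivative P \<tau> y ** V \<tau> y) (at y)"
    and U_\<tau>: "\<And>\<tau> y. \<tau> \<ge> \<tau>0 \<Longrightarrow> ((\<lambda>s. U s y) has_vector_derivative \<eta> \<tau> y) (at \<tau> within {\<tau>0..})"
    and U_y: "\<And>\<tau> y. \<tau> \<ge> \<tau>0 \<Longrightarrow> (U \<tau> has_vector_derivative Uy \<tau> y) (at y)"
    and V_\<tau>: "\<And>\<tau> y. \<tau> \<ge> \<tau>0 \<Longrightarrow>
      ((\<lambda>s. V s y) has_vector_derivative Uy \<tau> y + V \<tau> y ** U \<tau> y - U \<tau> y ** V \<tau> y) (at \<tau> within {\<tau>0..})"
    and wave: "\<And>\<tau> y. \<tau> \<ge> \<tau>0 \<Longrightarrow> ((\<lambda>z. (1 / m z) *\<^sub>R V \<tau> z) has_vector_derivative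
      (m y * exp (N * \<tau>) / N\<^sup>2) *\<^sub>R \<eta> \<tau> y) (at y)"
    and cont_P: "continuous_on ({\<tau>0..} \<times> UNIV) (\<lambda>(\<tau>, y). P \<tau> y)"
    and cont_U: "continuous_on ({\<tau>0..} \<times> UNIV) (\<lambda>(\<tau>, y). U \<tau> y)"
    and cont_V: "continuous_on ({\<tau>0..} \<times> UNIV) (\<lambda>(\<tau>, y). V \<tau> y)"
    and cont_\<eta>: "continuous_on ({\<tau>0..} \<times> UNIV) (\<lambda>(\<tau>, y). \<eta> \<tau> y)"
    and cont_Uy: "continuous_on ({\<tau>0..} \<times> UNIV) (\<lambda>(\<tau>, y). Uy \<tau> y)"
    and m_pos: "\<And>y. 0 < m y"
    and m_periodic: "\<And>y. m (y + 1) = m y"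
    and cont_m: "continuous_on UNIV m"
begin

abbreviation "Pinv \<tau> y \<equiv> matrix_inv (P \<tau> y)"

lemma invertible_P: "\<tau> \<ge> \<tau>0 \<Longrightarrow> invertible (P \<tau> y)"
  using invertible_posdef posdef_P by blast

lemma m_nonzero [simp]: "m y \<noteq> 0"
  using m_pos[of y] by simp

lemma cont_Pinv: "continuous_on ({\<tau>0..} \<times> UNIV) (\<lambda>(\<tau>, y). Pinv \<tau> y)"
  using continuous_on_matrix_inv[OF cont_P] by (auto simp: case_prod_unfold invertible_P)

lemma continuous_on_strip:
  assumes "continuous_on ({\<tau>0..} \<times> UNIV) (\<lambda>(\<tau>, y). f \<tau> y)"
    "continuous_on S a" "continuous_on S b" "\<And>x. x \<in> S \<Longrightarrow> a x \<ge> \<tau>0"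
  shows "continuous_on S (\<lambda>x. f (a x) (b x))"
  using continuous_on_compose2[OF assms(1), of S "\<lambda>x. (a x, b x)"] assms(2-)
  by (auto intro: continuous_intros)

lemma continuous_on_m [continuous_intros]: "continuous_on S f \<Longrightarrow> continuous_on S (\<lambda>x. m (f x))"
  using continuous_on_compose2[OF cont_m] by blast

lemmas strip_intros = continuous_intros matrix_mult.continuous_on
  bounded_linear.continuous_on[OF bounded_linear_trace]
  continuous_on_strip[OF cont_P] continuous_on_strip[OF cont_Pinv] continuous_on_strip[OF cont_U]
  continuous_on_strip[OF cont_V] continuous_on_strip[OF cont_\<eta>] continuous_on_strip[OF cont_Uy]

text \<open>Cyclicity of the trace. Applied with C = U in the energy identity and with C = \<sigma>
  / 2 to exchange the plain for the covariant derivative of a section.\<close>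

lemma trace_comm_derivative: "trace (V \<tau> y ** (B + V \<tau> y ** C - C ** V \<tau> y)) = trace (V \<tau> y ** B)"
proof -
  have "trace (V \<tau> y ** (C ** V \<tau> y)) = trace (V \<tau> y ** (V \<tau> y ** C))"
    by (metis matrix_mul_assoc trace_mul_sym)
  then show ?thesis
    by (simp add: matrix_mult.add_right matrix_mult.diff_right trace_add trace_sub)
qed

definition Q :: "real \<Rightarrow> real" where
  "Q \<tau> = integral {0..1} (\<lambda>y. trace (V \<tau> y ** V \<tau> y) / m y)"

definition energy_density :: "real \<Rightarrow> real \<Rightarrow> real" where
  "energy_density \<tau> y = trace (U \<tau> y ** U \<tau> y) * m y + N\<^sup>2 * exp (- N * \<tau>) * (trace (V \<tau> y ** V \<tau> y) / m y)"

definition energy :: "real \<Rightarrow> real" where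
  "energy \<tau> = integral {0..1} (energy_density \<tau>)"

lemma trace_UU_nonneg: "\<tau> \<ge> \<tau>0 \<Longrightarrow> 0 \<le> trace (U \<tau> y ** U \<tau> y)"
  by (rule trace_square_self_adjoint_nonneg[OF symmetric_P posdef_P self_adjoint_U])

lemma trace_VV_nonneg: "\<tau> \<ge> \<tau>0 \<Longrightarrow> 0 \<le> trace (V \<tau> y ** V \<tau> y)"
  by (rule trace_square_self_adjoint_nonneg[OF symmetric_P posdef_P self_adjoint_V])

lemma Q_nonneg: "\<tau> \<ge> \<tau>0 \<Longrightarrow> 0 \<le> Q \<tau>"
  unfolding Q_def
  by (intro integral_nonneg integrable_continuous_interval strip_intros)
    (auto simp: trace_VV_nonneg m_pos[THEN less_imp_le])

lemma energy_nonneg: "\<tau> \<ge> \<tau>0 \<Longrightarrow> 0 \<le> energy \<tau>"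
  unfolding energy_def energy_density_def
  by (intro integral_nonneg integrable_continuous_interval strip_intros)
    (auto simp: trace_VV_nonneg trace_UU_nonneg m_pos[THEN less_imp_le])

lemma continuous_on_Q: "continuous_on {\<tau>0..} Q"
proof -
  have "continuous_on {\<tau>0..} (\<lambda>\<tau>. integral (cbox 0 1) (\<lambda>y. trace (V \<tau> y ** V \<tau> y) / m y))"
    by (intro integral_continuous_on_param) (auto simp: case_prod_unfold intro!: strip_intros)
  then show ?thesis
    by (simp add: Q_def[abs_def])
qed

text \<open>Pairing the wave equation with a section: the flux \<open>trace (V \<sigma>) / m\<close> is periodic, so its
  derivative integrates to zero.\<close>

lemma integral_flux:
  fixes \<sigma> \<sigma>' :: "real \<Rightarrow> real^'n^'n"
  assumes \<tau>: "\<tau> \<ge> \<tau>0" and \<sigma>: "\<And>y. (\<sigma> has_vector_derivative \<sigma>' y) (at y)"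
    and periodic: "\<sigma> 1 = matrix_inv A ** \<sigma> 0 ** A"
  shows "((\<lambda>y. m y * exp (N * \<tau>) / N\<^sup>2 * trace (\<eta> \<tau> y ** \<sigma> y) + trace (V \<tau> y ** \<sigma>' y) / m y) has_integral 0) {0..1}"
proof -
  define w where "w y = trace (((1 / m y) *\<^sub>R V \<tau> y) ** \<sigma> y)" for y
  have w: "w y = trace (V \<tau> y ** \<sigma> y) / m y" for y
    by (simp add: w_def matrix_mult.scaleR_left trace_scaleR)
  have "V \<tau> 1 ** \<sigma> 1 = matrix_inv A ** (V \<tau> 0 ** \<sigma> 0) ** A"
    using equivariant_V[OF \<tau>, of 0] periodic
    by (simp add: matrix_mul_assoc[symmetric] matrix_inv_cancel_left(1)[OF invertible_A])
  then have "w 1 = w 0"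
    using m_periodic[of 0] by (simp add: w trace_conj invertible_A)
  moreover have "(w has_vector_derivative m y * exp (N * \<tau>) / N\<^sup>2 * trace (\<eta> \<tau> y ** \<sigma> y) + trace (V \<tau> y ** \<sigma>' y) / m y) (at y within {0..1})" for y
  proof (rule has_vector_derivative_at_within)
    have "(w has_vector_derivative trace (((1 / m y) *\<^sub>R V \<tau> y) ** \<sigma>' y + ((m y * exp (N * \<tau>) / N\<^sup>2) *\<^sub>R \<eta> \<tau> y) ** \<sigma> y)) (at y)"
      unfolding w_def
      by (intro bounded_linear.has_vector_derivative[OF bounded_linear_trace]
          matrix_mult.has_vector_derivative wave \<sigma> \<tau>)
    then show "(w has_vector_derivative m y * exp (N * \<tau>) / N\<^sup>2 * trace (\<eta> \<tau> y ** \<sigma> y) + trace (V \<tau> y ** \<sigma>' y) / m y) (at y)"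
      by (simp add: trace_add matrix_mult.scaleR_left trace_scaleR add.commute)
  qed
  ultimately show ?thesis
    using fundamental_theorem_of_calculus[of 0 1 w] by simp
qed

text \<open>The terms with \<open>\<eta>\<close> and \<open>Uy\<close> add up to 2 N^2 exp (- N
  \<tau>) times the integrand of \<open>integral_flux\<close> for the section \<sigma> = U, so they
  integrate to zero. What is left is the derivative of the factor N^2 exp (- N \<tau>) in front of
  \<open>Q\<close>.\<close>

lemma energy_derivative:
  assumes \<tau>: "\<tau> \<ge> \<tau>0"
  shows "(energy has_vector_derivative - (N ^ 3 * exp (- N * \<tau>) * Q \<tau>)) (at \<tau> within {\<tau>0..})"
proof -
  define D where "D \<tau> y = 2 * trace (\<eta> \<tau> y ** U \<tau> y) * m y
      + (2 * N\<^sup>2 * exp (- N * \<tau>) * (trace (V \<tau> y ** Uy \<tau> y) / m y)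
      - N ^ 3 * exp (- N * \<tau>) * (trace (V \<tau> y ** V \<tau> y) / m y))" for \<tau> y
  have deriv: "((\<lambda>s. energy_density s y) has_vector_derivative D \<tau> y) (at \<tau> within {\<tau>0..})" if \<tau>: "\<tau> \<ge> \<tau>0" for \<tau> y
  proof -
    have "((\<lambda>s. trace (U s y ** U s y)) has_vector_derivative trace (U \<tau> y ** \<eta> \<tau> y + \<eta> \<tau> y ** U \<tau> y)) (at \<tau> within {\<tau>0..})"
      by (intro bounded_linear.has_vector_derivative[OF bounded_linear_trace]
          matrix_mult.has_vector_derivative U_\<tau> \<tau>)
    then have UU: "((\<lambda>s. trace (U s y ** U s y)) has_real_derivative 2 * trace (\<eta> \<tau> y ** U \<tau> y)) (at \<tau> within {\<tau>0..})"
      by (simp add: has_real_derivative_iff_has_vector_derivative trace_add trace_mul_sym[of "U \<tau> y"])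
    let ?V' = "Uy \<tau> y + V \<tau> y ** U \<tau> y - U \<tau> y ** V \<tau> y"
    have "((\<lambda>s. trace (V s y ** V s y)) has_vector_derivative trace (V \<tau> y ** ?V' + ?V' ** V \<tau> y)) (at \<tau> within {\<tau>0..})"
      by (intro bounded_linear.has_vector_derivative[OF bounded_linear_trace]
          matrix_mult.has_vector_derivative V_\<tau> \<tau>)
    then have VV: "((\<lambda>s. trace (V s y ** V s y)) has_real_derivative 2 * trace (V \<tau> y ** Uy \<tau> y)) (at \<tau> within {\<tau>0..})"
      by (simp add: has_real_derivative_iff_has_vector_derivative trace_add trace_mul_sym[of ?V'] trace_comm_derivative)
    have "((\<lambda>s. energy_density s y) has_real_derivative D \<tau> y) (at \<tau> within {\<tau>0..})"
      unfolding energy_density_def D_def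
      by (auto intro!: derivative_eq_intros UU VV simp: field_simps power2_eq_square power3_eq_cube)
    then show ?thesis
      by (simp add: has_real_derivative_iff_has_vector_derivative)
  qed
  have "((\<lambda>\<tau>. integral (cbox 0 1) (energy_density \<tau>)) has_vector_derivative integral (cbox 0 1) (D \<tau>)) (at \<tau> within {\<tau>0..})"
  proof (rule leibniz_rule_vector_derivative)
    show "continuous_on ({\<tau>0..} \<times> cbox 0 1) (\<lambda>(\<tau>, y). D \<tau> y)"
      unfolding D_def by (auto simp: case_prod_unfold intro!: strip_intros)
    show "energy_density \<tau> integrable_on cbox 0 1" if "\<tau> \<in> {\<tau>0..}" for \<tau>
      unfolding energy_density_def using that
      by (auto intro!: integrable_continuous_interval strip_intros)
  qed (use \<tau> deriv in auto)
  moreover have "integral {0..1} (D \<tau>) = - (N ^ 3 * exp (- N * \<tau>) * Q \<tau>)"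
  proof -
    have flux: "((\<lambda>y. m y * exp (N * \<tau>) / N\<^sup>2 * trace (\<eta> \<tau> y ** U \<tau> y) + trace (V \<tau> y ** Uy \<tau> y) / m y) has_integral 0) {0..1}"
      using \<tau> equivariant_U[OF \<tau>, of 0] by (intro integral_flux U_y) auto
    have Q: "((\<lambda>y. trace (V \<tau> y ** V \<tau> y) / m y) has_integral Q \<tau>) {0..1}"
      unfolding Q_def using \<tau>
      by (intro integrable_integral integrable_continuous_interval strip_intros) auto
    have "((\<lambda>y. 2 * N\<^sup>2 * exp (- N * \<tau>) * (m y * exp (N * \<tau>) / N\<^sup>2 * trace (\<eta> \<tau> y ** U \<tau> y) + trace (V \<tau> y ** Uy \<tau> y) / m y)
        - N ^ 3 * exp (- N * \<tau>) * (trace (V \<tau> y ** V \<tau> y) / m y)) has_integral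
        2 * N\<^sup>2 * exp (- N * \<tau>) * 0 - N ^ 3 * exp (- N * \<tau>) * Q \<tau>) {0..1}"
      by (intro has_integral_diff has_integral_mult_right flux Q)
    moreover have "2 * N\<^sup>2 * exp (- N * \<tau>) * (m y * exp (N * \<tau>) / N\<^sup>2 * trace (\<eta> \<tau> y ** U \<tau> y) + trace (V \<tau> y ** Uy \<tau> y) / m y)
        - N ^ 3 * exp (- N * \<tau>) * (trace (V \<tau> y ** V \<tau> y) / m y) = D \<tau> y" for y
      using N_pos by (simp add: D_def exp_minus field_simps power2_eq_square power3_eq_cube)
    ultimately have "(D \<tau> has_integral - (N ^ 3 * exp (- N * \<tau>) * Q \<tau>)) {0..1}"
      by simp
    then show ?thesis
      by (rule integral_unique)
  qed
  ultimately show ?thesis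
    by (simp add: energy_def[abs_def])
qed

text \<open>Over [\<tau>0, \<tau>0 + n] the integral is the drop of the energy, hence at most the
  initial energy because the energy stays nonnegative. Monotone convergence in n does the
  rest.\<close>

lemma nn_integral_dissipation: "(\<integral>\<^sup>+\<tau>\<in>{\<tau>0..}. ennreal (N ^ 3 * exp (- N * \<tau>) * Q \<tau>) \<partial>lborel) \<le> ennreal (energy \<tau>0)"
proof -
  define f where "f \<tau> = N ^ 3 * exp (- N * \<tau>) * Q \<tau>" for \<tau>
  have f_nonneg: "f \<tau> \<ge> 0" if "\<tau> \<ge> \<tau>0" for \<tau>
    using Q_nonneg[OF that] N_pos by (simp add: f_def)
  have cont: "continuous_on {\<tau>0..} f"
    unfolding f_def by (intro continuous_intros continuous_on_Q)
  have bound: "(\<integral>\<^sup>+\<tau>\<in>{\<tau>0..\<tau>0 + real n}. ennreal (f \<tau>) \<partial>lborel) \<le> ennreal (energy \<tau>0)" for n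
  proof -
    have "(f has_integral - energy (\<tau>0 + real n) - (- energy \<tau>0)) {\<tau>0..\<tau>0 + real n}"
    proof (rule fundamental_theorem_of_calculus)
      fix \<tau> assume "\<tau> \<in> {\<tau>0..\<tau>0 + real n}"
      then have "((\<lambda>\<tau>. - energy \<tau>) has_vector_derivative f \<tau>) (at \<tau> within {\<tau>0..})"
        using has_vector_derivative_minus[OF energy_derivative[of \<tau>]] by (simp add: f_def)
      then show "((\<lambda>\<tau>. - energy \<tau>) has_vector_derivative f \<tau>) (at \<tau> within {\<tau>0..\<tau>0 + real n})"
        by (rule has_vector_derivative_within_subset) auto
    qed simp
    then have "(\<integral>\<^sup>+\<tau>\<in>{\<tau>0..\<tau>0 + real n}. ennreal (f \<tau>) \<partial>lborel) = ennreal (energy \<tau>0 - energy (\<tau>0 + real n))"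
      using nn_integral_has_integral_lebesgue'[of "{\<tau>0..\<tau>0 + real n}" f] f_nonneg by simp
    also have "\<dots> \<le> ennreal (energy \<tau>0)"
      using energy_nonneg[of "\<tau>0 + real n"] by (intro ennreal_leI) auto
    finally show ?thesis .
  qed
  let ?f = "\<lambda>n \<tau>. ennreal (f \<tau>) * indicator {\<tau>0..\<tau>0 + real n} \<tau>"
  have meas: "?f n \<in> borel_measurable lborel" for n
  proof -
    have "(\<lambda>\<tau>. indicator {\<tau>0..\<tau>0 + real n} \<tau> *\<^sub>R f \<tau>) \<in> borel_measurable borel"
      by (intro borel_measurable_continuous_on_indicator continuous_on_subset[OF cont]) auto
    then have "(\<lambda>\<tau>. ennreal (indicator {\<tau>0..\<tau>0 + real n} \<tau> *\<^sub>R f \<tau>)) \<in> borel_measurable lborel"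
      by simp
    also have "(\<lambda>\<tau>. ennreal (indicator {\<tau>0..\<tau>0 + real n} \<tau> *\<^sub>R f \<tau>)) = ?f n"
      by (auto split: split_indicator)
    finally show ?thesis .
  qed
  have "(SUP n. ?f n \<tau>) = ennreal (f \<tau>) * indicator {\<tau>0..} \<tau>" for \<tau>
  proof (rule LIMSEQ_unique[OF LIMSEQ_SUP])
    obtain n where "\<tau> - \<tau>0 < real n"
      using reals_Archimedean2[of "\<tau> - \<tau>0"] ..
    then have "eventually (\<lambda>n. ?f n \<tau> = ennreal (f \<tau>) * indicator {\<tau>0..} \<tau>) sequentially"
      by (intro eventually_sequentiallyI[where c=n]) (auto split: split_indicator)
    then show "(\<lambda>n. ?f n \<tau>) \<longlonglongrightarrow> ennreal (f \<tau>) * indicator {\<tau>0..} \<tau>"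
      by (rule tendsto_eventually)
  qed (auto simp: incseq_def le_fun_def split: split_indicator)
  then have "(\<integral>\<^sup>+\<tau>. ennreal (f \<tau>) * indicator {\<tau>0..} \<tau> \<partial>lborel) = (\<integral>\<^sup>+\<tau>. (SUP n. ?f n \<tau>) \<partial>lborel)"
    by simp
  also have "\<dots> = (SUP n. \<integral>\<^sup>+\<tau>. ?f n \<tau> \<partial>lborel)"
    by (intro nn_integral_monotone_convergence_SUP meas)
      (auto simp: incseq_def le_fun_def split: split_indicator)
  also have "\<dots> \<le> ennreal (energy \<tau>0)"
    using bound by (intro SUP_least)
  finally show ?thesis
    by (simp add: f_def)
qed

section \<open>The bound on the dual norm\<close>

lemma cov_deriv_eq:
  assumes \<tau>: "\<tau> \<ge> \<tau>0" and \<sigma>: "(\<sigma> has_vector_derivative \<sigma>') (at y)"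
  shows "cov_deriv (P \<tau>) \<sigma> y = \<sigma>' + (1/2) *\<^sub>R (V \<tau> y ** \<sigma> y - \<sigma> y ** V \<tau> y)"
  using vector_derivative_at[OF P_y[OF \<tau>]] vector_derivative_at[OF \<sigma>]
  by (simp add: cov_deriv_def Let_def matrix_inv_cancel_left[OF invertible_P[OF \<tau>]])

lemma self_adjoint_iff:
  assumes \<tau>: "\<tau> \<ge> \<tau>0"
  shows "self_adjoint_section (P \<tau>) \<sigma> \<longleftrightarrow> (\<forall>y. transpose (P \<tau> y ** \<sigma> y) = P \<tau> y ** \<sigma> y)"
proof -
  have "transpose (\<sigma> y) = P \<tau> y ** \<sigma> y ** Pinv \<tau> y \<longleftrightarrow> transpose (P \<tau> y ** \<sigma> y) = P \<tau> y ** \<sigma> y" for y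
    unfolding matrix_transpose_mul symmetric_P[OF \<tau>]
    using matrix_inv_cancel[OF invertible_P[OF \<tau>]] by (metis matrix_mul_assoc matrix_mul_rid)
  then show ?thesis
    by (simp add: self_adjoint_section_def)
qed

text \<open>P times the covariant derivative is (P \<sigma>)_y - (P V \<sigma> + P \<sigma> V) / 2.
  The first term is symmetric as derivative of a symmetric form, and transposition swaps the two
  summands of the second. This is where the factor 1/2 in \<open>cov_deriv\<close> matters.\<close>

lemma self_adjoint_cov_deriv:
  assumes \<tau>: "\<tau> \<ge> \<tau>0" and sa: "self_adjoint_section (P \<tau>) \<sigma>"
    and \<sigma>: "(\<sigma> has_vector_derivative \<sigma>') (at y)"
  shows "transpose (P \<tau> y ** cov_deriv (P \<tau>) \<sigma> y) = P \<tau> y ** cov_deriv (P \<tau>) \<sigma> y"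
proof -
  let ?P = "P \<tau> y" and ?V = "V \<tau> y" and ?\<sigma> = "\<sigma> y"
  have sym: "transpose (P \<tau> z ** \<sigma> z) = P \<tau> z ** \<sigma> z" for z
    using sa by (simp add: self_adjoint_iff[OF \<tau>])
  define B where "B = ?P ** \<sigma>' + ?P ** ?V ** ?\<sigma>"
  have 1: "((\<lambda>z. P \<tau> z ** \<sigma> z) has_vector_derivative B) (at y)"
    unfolding B_def by (rule matrix_mult.has_vector_derivative[OF P_y[OF \<tau>] \<sigma>])
  have "((\<lambda>z. transpose (P \<tau> z ** \<sigma> z)) has_vector_derivative transpose B) (at y)"
    by (rule bounded_linear.has_vector_derivative[OF bounded_linear_transpose 1])
  then have B: "transpose B = B"
    unfolding sym using vector_derivative_unique_at 1 by blast
  have "transpose (?P ** ?V ** ?\<sigma>) = transpose ?\<sigma> ** ?P ** ?V"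
    using self_adjoint_V[OF \<tau>, of y] by (simp add: matrix_transpose_mul matrix_mul_assoc)
  also have "transpose ?\<sigma> ** ?P = ?P ** ?\<sigma>"
    using sym[of y] by (simp add: matrix_transpose_mul symmetric_P[OF \<tau>])
  finally have C: "transpose (?P ** ?V ** ?\<sigma>) = ?P ** ?\<sigma> ** ?V" .
  have C': "transpose (?P ** ?\<sigma> ** ?V) = ?P ** ?V ** ?\<sigma>"
    by (simp add: C[symmetric])
  have "?P ** cov_deriv (P \<tau>) \<sigma> y = B - (1/2) *\<^sub>R (?P ** ?V ** ?\<sigma> + ?P ** ?\<sigma> ** ?V)"
    unfolding cov_deriv_eq[OF \<tau> \<sigma>] B_def
    by (simp add: matrix_mult.add_right matrix_mult.diff_right matrix_mult.scaleR_right matrix_mul_assoc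
        scaleR_diff_right scaleR_add_right)
  then show ?thesis
    by (simp add: transpose_diff transpose_add transpose_scalar B C C' add.commute)
qed

text \<open>By the flux identity the numerator is - N^2 exp (- N \<tau>) B, where B pairs
  \<open>V\<close> with the covariant derivative of \<sigma>. Cauchy-Schwarz bounds B^2 by Q R, and
  R is the derivative part of the squared norm in the denominator, hence at most Z + R.\<close>

lemma pairing_bound:
  assumes \<tau>: "\<tau> \<ge> \<tau>0" and smooth: "smooth_End_section A \<sigma>" and sa: "self_adjoint_section (P \<tau>) \<sigma>"
  shows "integral {0..1} (\<lambda>y. trace (\<eta> \<tau> y ** \<sigma> y) * m y) / H1_norm (P \<tau>) m \<sigma> \<le> N\<^sup>2 * exp (- N * \<tau>) * sqrt (Q \<tau>)"
proof -
  obtain \<sigma>' where \<sigma>': "\<And>y. (\<sigma> has_vector_derivative \<sigma>' y) (at y)" "continuous_on UNIV \<sigma>'"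
    using smooth_on_deriv smooth by (metis smooth_End_section_def)
  have cont_\<sigma>: "continuous_on UNIV \<sigma>"
    using \<sigma>'(1) by (meson continuous_at_imp_continuous_on has_vector_derivative_continuous)
  note cont_sigma = continuous_on_subset[OF cont_\<sigma> subset_UNIV] continuous_on_subset[OF \<sigma>'(2) subset_UNIV]
  note intros = integrable_continuous_interval strip_intros cont_sigma
  have periodic: "\<sigma> 1 = matrix_inv A ** \<sigma> 0 ** A"
    using smooth unfolding smooth_End_section_def by (metis add_0)
  define D where "D y = cov_deriv (P \<tau>) \<sigma> y" for y
  have D: "D y = \<sigma>' y + (1/2) *\<^sub>R (V \<tau> y ** \<sigma> y - \<sigma> y ** V \<tau> y)" for y
    unfolding D_def by (rule cov_deriv_eq[OF \<tau> \<sigma>'(1)])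
  have cont_D: "continuous_on S D" for S
    unfolding D[abs_def] using \<tau> by (intro strip_intros cont_sigma) auto
  have SD: "transpose (P \<tau> y ** D y) = P \<tau> y ** D y" for y
    unfolding D_def by (rule self_adjoint_cov_deriv[OF \<tau> sa \<sigma>'(1)])
  have S\<sigma>: "transpose (P \<tau> y ** \<sigma> y) = P \<tau> y ** \<sigma> y" for y
    using sa by (simp add: self_adjoint_iff[OF \<tau>])
  have nonneg: "0 \<le> trace (S ** S)" if "transpose (P \<tau> y ** S) = P \<tau> y ** S" for S y
    by (rule trace_square_self_adjoint_nonneg[OF symmetric_P posdef_P that]) (use \<tau> in auto)
  define B where "B = integral {0..1} (\<lambda>y. trace (V \<tau> y ** D y) / m y)"
  define R where "R = integral {0..1} (\<lambda>y. trace (D y ** D y) / m y)"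
  define Z where "Z = integral {0..1} (\<lambda>y. trace (\<sigma> y ** \<sigma> y) * m y)"
  have int_Q: "((\<lambda>y. trace (V \<tau> y ** V \<tau> y) / m y) has_integral Q \<tau>) {0..1}"
    and int_B: "((\<lambda>y. trace (V \<tau> y ** D y) / m y) has_integral B) {0..1}"
    and int_R: "((\<lambda>y. trace (D y ** D y) / m y) has_integral R) {0..1}"
    and int_Z: "((\<lambda>y. trace (\<sigma> y ** \<sigma> y) * m y) has_integral Z) {0..1}"
    unfolding Q_def B_def R_def Z_def using \<tau>
    by (intro integrable_integral intros cont_D; auto)+
  have "R \<ge> 0"
    using int_R by (rule has_integral_nonneg) (simp add: nonneg[OF SD] m_pos less_imp_le)
  have "Z \<ge> 0"
    using int_Z by (rule has_integral_nonneg) (simp add: nonneg[OF S\<sigma>] m_pos less_imp_le)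
  \<comment> \<open>The quadratic polynomial in s is the integral of Tr ((V + s D)^2) / m, which is
    nonnegative since V + s D is self-adjoint.\<close>
  have CS: "B\<^sup>2 \<le> Q \<tau> * R"
  proof (rule quadratic_nonneg_discriminant)
    fix s
    have eq: "trace (V \<tau> y ** V \<tau> y) / m y + 2 * s * (trace (V \<tau> y ** D y) / m y) + s\<^sup>2 * (trace (D y ** D y) / m y)
      = trace ((V \<tau> y + s *\<^sub>R D y) ** (V \<tau> y + s *\<^sub>R D y)) / m y" for y
      using trace_mul_sym[of "D y" "V \<tau> y"]
      by (simp add: matrix_mult.add_left matrix_mult.add_right matrix_mult.scaleR_left matrix_mult.scaleR_right
          trace_add trace_scaleR power2_eq_square field_simps)
    have "((\<lambda>y. trace (V \<tau> y ** V \<tau> y) / m y + 2 * s * (trace (V \<tau> y ** D y) / m y) + s\<^sup>2 * (trace (D y ** D y) / m y))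
      has_integral Q \<tau> + 2 * s * B + s\<^sup>2 * R) {0..1}"
      by (intro has_integral_add has_integral_mult_right int_Q int_B int_R)
    then show "0 \<le> Q \<tau> + 2 * s * B + s\<^sup>2 * R"
    proof (rule has_integral_nonneg)
      fix y :: real
      have "transpose (P \<tau> y ** (V \<tau> y + s *\<^sub>R D y)) = P \<tau> y ** (V \<tau> y + s *\<^sub>R D y)"
        using SD[of y] self_adjoint_V[OF \<tau>, of y]
        by (simp add: matrix_mult.add_right matrix_mult.scaleR_right transpose_add transpose_scalar)
      then show "0 \<le> trace (V \<tau> y ** V \<tau> y) / m y + 2 * s * (trace (V \<tau> y ** D y) / m y) + s\<^sup>2 * (trace (D y ** D y) / m y)"
        unfolding eq by (simp add: nonneg m_pos less_imp_le)
    qed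
  qed
  \<comment> \<open>The connection term of D is a commutator with \<open>V\<close>, so it drops out
    of the trace against \<open>V\<close>.\<close>
  have VD: "trace (V \<tau> y ** D y) = trace (V \<tau> y ** \<sigma>' y)" for y
    unfolding D using trace_comm_derivative[of \<tau> y "\<sigma>' y" "(1/2) *\<^sub>R \<sigma> y"]
    by (simp add: matrix_mult.scaleR_left matrix_mult.scaleR_right scaleR_diff_right algebra_simps)
  have "((\<lambda>y. N\<^sup>2 * exp (- N * \<tau>) * (m y * exp (N * \<tau>) / N\<^sup>2 * trace (\<eta> \<tau> y ** \<sigma> y) + trace (V \<tau> y ** \<sigma>' y) / m y)
      - N\<^sup>2 * exp (- N * \<tau>) * (trace (V \<tau> y ** D y) / m y)) has_integral
      N\<^sup>2 * exp (- N * \<tau>) * 0 - N\<^sup>2 * exp (- N * \<tau>) * B) {0..1}"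
    by (intro has_integral_diff has_integral_mult_right int_B integral_flux \<tau> \<sigma>' periodic)
  moreover have "N\<^sup>2 * exp (- N * \<tau>) * (m y * exp (N * \<tau>) / N\<^sup>2 * trace (\<eta> \<tau> y ** \<sigma> y) + trace (V \<tau> y ** \<sigma>' y) / m y)
      - N\<^sup>2 * exp (- N * \<tau>) * (trace (V \<tau> y ** D y) / m y) = trace (\<eta> \<tau> y ** \<sigma> y) * m y" for y
    using N_pos by (simp add: VD exp_minus field_simps)
  ultimately have num: "integral {0..1} (\<lambda>y. trace (\<eta> \<tau> y ** \<sigma> y) * m y) = - (N\<^sup>2 * exp (- N * \<tau>) * B)"
    by (simp add: integral_unique)
  have den: "H1_norm (P \<tau>) m \<sigma> = sqrt (Z + R)"
    using integral_unique[OF has_integral_add[OF int_Z int_R]] by (simp add: H1_norm_def D_def)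
  have "- B \<le> sqrt (B\<^sup>2)"
    by simp
  also have "\<dots> \<le> sqrt (Q \<tau> * R)"
    using CS by (rule real_sqrt_le_mono)
  also have "\<dots> \<le> sqrt (Q \<tau>) * sqrt (Z + R)"
    unfolding real_sqrt_mult using \<open>Z \<ge> 0\<close> Q_nonneg[OF \<tau>] by (intro mult_left_mono) auto
  finally have "N\<^sup>2 * exp (- N * \<tau>) * (- B) \<le> N\<^sup>2 * exp (- N * \<tau>) * (sqrt (Q \<tau>) * sqrt (Z + R))"
    by (intro mult_left_mono) auto
  \<comment> \<open>If Z + R = 0, the quotient is a division by zero, hence 0, and the bound holds
    since its right side is nonnegative.\<close>
  then show ?thesis
    unfolding num den using \<open>Z \<ge> 0\<close> \<open>R \<ge> 0\<close> Q_nonneg[OF \<tau>]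
    by (cases "Z + R = 0") (auto simp: divide_simps mult_ac)
qed

text \<open>Squaring the bound produces exp (- 2 N \<tau>), of which the weight cancels one half.
  The remaining N^4 exp (- N \<tau>) Q is split so that the second factor is the dissipation rate of
  \<open>energy_derivative\<close>.\<close>

lemma Hminus1_norm_bound:
  assumes "\<tau> \<ge> \<tau>0"
  shows "ennreal (exp (N * \<tau>)) * (Hminus1_norm A (P \<tau>) m (\<eta> \<tau>))\<^sup>2 \<le> ennreal N * ennreal (N ^ 3 * exp (- N * \<tau>) * Q \<tau>)"
proof -
  note Q = Q_nonneg[OF assms]
  have "Hminus1_norm A (P \<tau>) m (\<eta> \<tau>) \<le> ennreal (N\<^sup>2 * exp (- N * \<tau>) * sqrt (Q \<tau>))"
    unfolding Hminus1_norm_def by (intro SUP_least ennreal_leI pairing_bound assms) auto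
  then have "ennreal (exp (N * \<tau>)) * (Hminus1_norm A (P \<tau>) m (\<eta> \<tau>))\<^sup>2
      \<le> ennreal (exp (N * \<tau>)) * (ennreal (N\<^sup>2 * exp (- N * \<tau>) * sqrt (Q \<tau>)))\<^sup>2"
    by (intro mult_left_mono power_mono) auto
  also have "\<dots> = ennreal (exp (N * \<tau>) * (N\<^sup>2 * exp (- N * \<tau>) * sqrt (Q \<tau>))\<^sup>2)"
    using Q by (subst ennreal_power) (auto simp flip: ennreal_mult)
  also have "exp (N * \<tau>) * (N\<^sup>2 * exp (- N * \<tau>) * sqrt (Q \<tau>))\<^sup>2 = N * (N ^ 3 * exp (- N * \<tau>) * Q \<tau>)"
    using Q by (simp add: power_mult_distrib exp_minus power2_eq_square power3_eq_cube field_simps)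
  also have "ennreal \<dots> = ennreal N * ennreal (N ^ 3 * exp (- N * \<tau>) * Q \<tau>)"
    using Q N_pos by (simp add: ennreal_mult)
  finally show ?thesis .
qed

lemma nn_integral_Hminus1_norm_finite:
  "(\<integral>\<^sup>+\<tau>\<in>{\<tau>0..}. (ennreal (exp (N * \<tau>)) * (Hminus1_norm A (P \<tau>) m (\<eta> \<tau>))\<^sup>2) \<partial>lborel) < \<infinity>"
proof -
  have meas: "(\<lambda>\<tau>. ennreal (N ^ 3 * exp (- N * \<tau>) * Q \<tau>) * indicator {\<tau>0..} \<tau>) \<in> borel_measurable lborel"
  proof -
    have "(\<lambda>\<tau>. indicator {\<tau>0..} \<tau> *\<^sub>R (N ^ 3 * exp (- N * \<tau>) * Q \<tau>)) \<in> borel_measurable borel"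
      by (intro borel_measurable_continuous_on_indicator continuous_intros continuous_on_Q) auto
    then have "(\<lambda>\<tau>. ennreal (indicator {\<tau>0..} \<tau> *\<^sub>R (N ^ 3 * exp (- N * \<tau>) * Q \<tau>))) \<in> borel_measurable lborel"
      by simp
    also have "(\<lambda>\<tau>. ennreal (indicator {\<tau>0..} \<tau> *\<^sub>R (N ^ 3 * exp (- N * \<tau>) * Q \<tau>))) = (\<lambda>\<tau>. ennreal (N ^ 3 * exp (- N * \<tau>) * Q \<tau>) * indicator {\<tau>0..} \<tau>)"
      by (auto split: split_indicator)
    finally show ?thesis .
  qed
  have "(\<integral>\<^sup>+\<tau>\<in>{\<tau>0..}. (ennreal (exp (N * \<tau>)) * (Hminus1_norm A (P \<tau>) m (\<eta> \<tau>))\<^sup>2) \<partial>lborel)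
      \<le> (\<integral>\<^sup>+\<tau>. ennreal N * (ennreal (N ^ 3 * exp (- N * \<tau>) * Q \<tau>) * indicator {\<tau>0..} \<tau>) \<partial>lborel)"
    using Hminus1_norm_bound by (intro nn_integral_mono) (auto split: split_indicator)
  also have "\<dots> = ennreal N * (\<integral>\<^sup>+\<tau>\<in>{\<tau>0..}. ennreal (N ^ 3 * exp (- N * \<tau>) * Q \<tau>) \<partial>lborel)"
    by (rule nn_integral_cmult[OF meas])
  also have "\<dots> \<le> ennreal N * ennreal (energy \<tau>0)"
    by (intro mult_left_mono nn_integral_dissipation) simp
  also have "\<dots> < \<infinity>"
    by (simp add: ennreal_mult_less_top)
  finally show ?thesis .
qed

text \<open>Multiplication by \<open>P\<close> turns self-adjoint sections, a class that depends on \<open>\<tau>\<close>, into symmetric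
  forms, a class that does not. The dual norm is thus a supremum of functions of \<open>\<tau>\<close> over a fixed
  index set, each of them continuous where positive.\<close>

definition symmetric_forms :: "(real \<Rightarrow> real^'n^'n) set" where
  "symmetric_forms = {S. smooth_on UNIV S \<and> (\<forall>y. S (y + 1) = transpose A ** S y ** A) \<and>
     (\<forall>y. transpose (S y) = S y) \<and> S \<noteq> (\<lambda>y. 0)}"

text \<open>\<open>P\<close> transforms as a bilinear form under the holonomy and \<sigma> by
  conjugation, so P \<sigma> is again a bilinear form. Self-adjointness of \<sigma> is the symmetry
  of P \<sigma>.\<close>

lemma self_adjoint_sections_eq:
  assumes \<tau>: "\<tau> \<ge> \<tau>0"
  shows "{\<sigma>. smooth_End_section A \<sigma> \<and> self_adjoint_section (P \<tau>) \<sigma> \<and> \<sigma> \<noteq> (\<lambda>y. 0)} =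
    (\<lambda>S y. Pinv \<tau> y ** S y) ` symmetric_forms"
proof (intro equalityI subsetI)
  note cancel = matrix_inv_cancel_left[OF invertible_P[OF \<tau>]]
  note smooth = smooth_P[OF \<tau>, unfolded smooth_on_def, rule_format]
  {
    fix \<sigma> assume \<sigma>: "\<sigma> \<in> {\<sigma>. smooth_End_section A \<sigma> \<and> self_adjoint_section (P \<tau>) \<sigma> \<and> \<sigma> \<noteq> (\<lambda>y. 0)}"
    define S where "S y = P \<tau> y ** \<sigma> y" for y
    have "smooth_on UNIV S"
      using \<sigma> smooth by (auto simp: smooth_on_def S_def[abs_def] smooth_End_section_def intro!: matrix_mult.Ck_on)
    moreover have "S (y + 1) = transpose A ** S y ** A" for y
      using \<sigma> by (simp add: S_def smooth_End_section_def equivariant_P \<tau> matrix_mul_assoc[symmetric]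
          matrix_inv_cancel_left(1)[OF invertible_A])
    moreover have "transpose (S y) = S y" for y
      using \<sigma> by (simp add: S_def self_adjoint_iff[OF \<tau>])
    moreover have \<sigma>_eq: "\<sigma> = (\<lambda>y. Pinv \<tau> y ** S y)"
      by (simp add: S_def cancel)
    moreover have "S \<noteq> (\<lambda>y. 0)"
      using \<sigma> \<sigma>_eq by (auto simp: matrix_mult.zero_right)
    ultimately show "\<sigma> \<in> (\<lambda>S y. Pinv \<tau> y ** S y) ` symmetric_forms"
      unfolding symmetric_forms_def by blast
  next
    fix \<sigma> assume "\<sigma> \<in> (\<lambda>S y. Pinv \<tau> y ** S y) ` symmetric_forms"
    then obtain S where S: "S \<in> symmetric_forms" and \<sigma>: "\<sigma> = (\<lambda>y. Pinv \<tau> y ** S y)"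
      by blast
    have S_eq: "S y = P \<tau> y ** \<sigma> y" for y
      by (simp add: \<sigma> cancel)
    have "smooth_on UNIV \<sigma>"
      using S smooth by (auto simp: smooth_on_def \<sigma> symmetric_forms_def
          intro!: matrix_mult.Ck_on Ck_on_matrix_inv invertible_P \<tau>)
    moreover have "\<sigma> (y + 1) = matrix_inv A ** \<sigma> y ** A" for y
    proof -
      \<comment> \<open>Equivariance is checked after multiplication by the invertible matrix
        \<open>P \<tau> (y + 1)\<close>.\<close>
      have "P \<tau> (y + 1) ** (matrix_inv A ** \<sigma> y ** A) = transpose A ** S y ** A"
        by (simp add: equivariant_P \<tau> S_eq matrix_mul_assoc[symmetric] matrix_inv_cancel_left(1)[OF invertible_A])
      also have "\<dots> = S (y + 1)"
        using S by (simp add: symmetric_forms_def)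
      finally have "Pinv \<tau> (y + 1) ** (P \<tau> (y + 1) ** (matrix_inv A ** \<sigma> y ** A)) = \<sigma> (y + 1)"
        by (simp add: \<sigma>)
      then show ?thesis
        by (simp only: cancel)
    qed
    moreover have "self_adjoint_section (P \<tau>) \<sigma>"
      using S by (simp add: self_adjoint_iff[OF \<tau>] S_eq[symmetric] symmetric_forms_def)
    moreover have "\<sigma> \<noteq> (\<lambda>y. 0)"
    proof
      assume "\<sigma> = (\<lambda>y. 0)"
      then have "S = (\<lambda>y. 0)"
        by (simp add: S_eq fun_eq_iff matrix_mult.zero_right)
      then show False
        using S by (simp add: symmetric_forms_def)
    qed
    ultimately show "\<sigma> \<in> {\<sigma>. smooth_End_section A \<sigma> \<and> self_adjoint_section (P \<tau>) \<sigma> \<and> \<sigma> \<noteq> (\<lambda>y. 0)}"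
      by (simp add: smooth_End_section_def)
  }
qed

text \<open>Numerator and denominator are continuous in \<tau>, so the quotient can fail to be
  continuous only where the denominator is 0. There it takes the value 0 by convention, which never
  exceeds \<open>a\<close>; restricting to the open set \<open>T\<close> of nonzero denominators
  therefore loses nothing.\<close>

lemma quotient_superlevel_open:
  assumes S: "S \<in> symmetric_forms"
  shows "openin (top_of_set {\<tau>0..}) {\<tau>\<in>{\<tau>0..}. a < ennreal
    (integral {0..1} (\<lambda>y. trace (\<eta> \<tau> y ** (Pinv \<tau> y ** S y)) * m y) / H1_norm (P \<tau>) m (\<lambda>y. Pinv \<tau> y ** S y))}"
proof -
  obtain S' where S': "\<And>y. (S has_vector_derivative S' y) (at y)" "continuous_on UNIV S'"
    using smooth_on_deriv S by (metis (mono_tags, lifting) symmetric_forms_def mem_Collect_eq)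
  have cont_S: "continuous_on UNIV S"
    using S'(1) by (meson continuous_at_imp_continuous_on has_vector_derivative_continuous)
  note intros = strip_intros continuous_on_compose2[OF cont_S] continuous_on_compose2[OF S'(2)]
  define num where "num \<tau> = integral (cbox 0 1) (\<lambda>y. trace (\<eta> \<tau> y ** (Pinv \<tau> y ** S y)) * m y)" for \<tau>
  \<comment> \<open>The covariant derivative of P^-1 S written out by means of (P^-1)_y = - V P^-1,
    which makes its joint continuity in \<tau> and y visible.\<close>
  define D where "D \<tau> y = Pinv \<tau> y ** S' y - V \<tau> y ** Pinv \<tau> y ** S y
      + (1/2) *\<^sub>R (V \<tau> y ** (Pinv \<tau> y ** S y) - Pinv \<tau> y ** S y ** V \<tau> y)" for \<tau> y
  define den where "den \<tau> = sqrt (integral (cbox 0 1) (\<lambda>y.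
      trace (Pinv \<tau> y ** S y ** (Pinv \<tau> y ** S y)) * m y + trace (D \<tau> y ** D \<tau> y) / m y))" for \<tau>
  have den: "H1_norm (P \<tau>) m (\<lambda>y. Pinv \<tau> y ** S y) = den \<tau>" if \<tau>: "\<tau> \<ge> \<tau>0" for \<tau>
  proof -
    have "((\<lambda>y. Pinv \<tau> y ** S y) has_vector_derivative
        Pinv \<tau> y ** S' y + (- (Pinv \<tau> y ** (P \<tau> y ** V \<tau> y) ** Pinv \<tau> y)) ** S y) (at y)" for y
      by (intro matrix_mult.has_vector_derivative S' has_vector_derivative_matrix_inv P_y \<tau> invertible_P) simp
    then have "((\<lambda>y. Pinv \<tau> y ** S y) has_vector_derivative Pinv \<tau> y ** S' y - V \<tau> y ** Pinv \<tau> y ** S y) (at y)" for y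
      by (simp add: matrix_inv_cancel_left[OF invertible_P[OF \<tau>]] matrix_mult.minus_left)
    then have "cov_deriv (P \<tau>) (\<lambda>y. Pinv \<tau> y ** S y) y = D \<tau> y" for y
      unfolding D_def by (rule cov_deriv_eq[OF \<tau>])
    then show ?thesis
      by (simp add: H1_norm_def den_def)
  qed
  have cont_num: "continuous_on {\<tau>0..} num"
    unfolding num_def by (intro integral_continuous_on_param) (auto simp: case_prod_unfold intro!: intros)
  have cont_den: "continuous_on {\<tau>0..} den"
    unfolding den_def D_def
    by (intro continuous_on_real_sqrt integral_continuous_on_param) (auto simp: case_prod_unfold intro!: intros)
  define T where "T = {\<tau>0..} \<inter> den -` (- {0})"
  have T: "openin (top_of_set {\<tau>0..}) T"
    unfolding T_def by (rule continuous_openin_preimage_gen[OF cont_den]) auto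
  have "continuous_on T (\<lambda>\<tau>. ennreal (num \<tau> / den \<tau>))"
    by (intro continuous_on_ennreal continuous_on_divide continuous_on_subset[OF cont_num] continuous_on_subset[OF cont_den])
      (auto simp: T_def)
  then have "openin (top_of_set T) (T \<inter> (\<lambda>\<tau>. ennreal (num \<tau> / den \<tau>)) -` {a<..})"
    by (rule continuous_openin_preimage_gen) auto
  then have "openin (top_of_set {\<tau>0..}) (T \<inter> (\<lambda>\<tau>. ennreal (num \<tau> / den \<tau>)) -` {a<..})"
    using T openin_trans by blast
  also have "T \<inter> (\<lambda>\<tau>. ennreal (num \<tau> / den \<tau>)) -` {a<..} = {\<tau>\<in>{\<tau>0..}. a < ennreal
    (integral {0..1} (\<lambda>y. trace (\<eta> \<tau> y ** (Pinv \<tau> y ** S y)) * m y) / H1_norm (P \<tau>) m (\<lambda>y. Pinv \<tau> y ** S y))}"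
    by (auto simp: T_def den num_def)
  finally show ?thesis .
qed

text \<open>A supremum of uncountably many measurable functions need not be measurable, but
  relatively open superlevel sets survive arbitrary unions: the dual norm is lower semicontinuous in
  \<tau>.\<close>

lemma measurable_Hminus1_norm:
  "(\<lambda>\<tau>. Hminus1_norm A (P \<tau>) m (\<eta> \<tau>)) \<in> borel_measurable (restrict_space lborel {\<tau>0..})"
proof (rule borel_measurableI_greater)
  fix a :: ennreal
  let ?q = "\<lambda>S \<tau>. ennreal (integral {0..1} (\<lambda>y. trace (\<eta> \<tau> y ** (Pinv \<tau> y ** S y)) * m y) / H1_norm (P \<tau>) m (\<lambda>y. Pinv \<tau> y ** S y))"
  have "Hminus1_norm A (P \<tau>) m (\<eta> \<tau>) = (SUP S\<in>symmetric_forms. ?q S \<tau>)" if "\<tau> \<ge> \<tau>0" for \<tau>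
    unfolding Hminus1_norm_def self_adjoint_sections_eq[OF that] by (simp add: image_image)
  then have "{\<tau> \<in> {\<tau>0..}. a < Hminus1_norm A (P \<tau>) m (\<eta> \<tau>)} = (\<Union>S\<in>symmetric_forms. {\<tau>\<in>{\<tau>0..}. a < ?q S \<tau>})"
    by (auto simp: less_SUP_iff)
  moreover have "openin (top_of_set {\<tau>0..}) (\<Union>S\<in>symmetric_forms. {\<tau>\<in>{\<tau>0..}. a < ?q S \<tau>})"
    by (intro openin_Union) (use quotient_superlevel_open in blast)
  ultimately obtain W where "open W" "{\<tau> \<in> {\<tau>0..}. a < Hminus1_norm A (P \<tau>) m (\<eta> \<tau>)} = {\<tau>0..} \<inter> W"
    by (auto simp: openin_open)
  then show "{\<tau> \<in> space (restrict_space lborel {\<tau>0..}). a < Hminus1_norm A (P \<tau>) m (\<eta> \<tau>)} \<in> sets (restrict_space lborel {\<tau>0..})"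
    by (auto simp: space_restrict_space sets_restrict_space)
qed

end

subsection \<open>The Ricci tensor\<close>

lemma sum_coord: "(\<Sum>k\<in>UNIV. f k) = f TC + f YC + (\<Sum>I\<in>UNIV. f (XC I))"
  for f :: "'n::finite coord \<Rightarrow> 'a::comm_monoid_add"
proof -
  have UNIV: "(UNIV :: 'n coord set) = insert TC (insert YC (range XC))"
    using coord.exhaust by blast
  show ?thesis
    unfolding UNIV by (subst sum.insert; (subst sum.insert)?) (auto simp: sum.reindex inj_on_def add.assoc)
qed

section \<open>Coordinate derivatives of functions of t and y\<close>

lemma partial_deriv_TC:
  fixes p :: "real^('n::finite coord)"
  assumes p: "p \<in> spacetime_domain t0"
    and f: "\<And>q. q \<in> spacetime_domain t0 \<Longrightarrow> f q = \<phi> (q $ TC) (q $ YC)"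
    and D: "((\<lambda>s. \<phi> s (p $ YC)) has_real_derivative D) (at (p $ TC) within {0<..t0})"
  shows "partial_deriv (spacetime_domain t0) TC f p = D"
proof -
  let ?t = "p $ TC"
  let ?S = "{s. p + s *\<^sub>R axis TC 1 \<in> spacetime_domain t0}"
  have S: "?S = {- ?t<..t0 - ?t}"
    by (auto simp: spacetime_domain_def)
  have "(+) ?t ` {- ?t<..t0 - ?t} \<subseteq> {0<..t0}"
    by auto
  then have "((\<lambda>s. \<phi> s (p $ YC)) \<circ> (+) ?t has_real_derivative D * 1) (at 0 within {- ?t<..t0 - ?t})"
    by (intro DERIV_image_chain) (auto intro!: derivative_eq_intros DERIV_subset[OF D])
  then have "((\<lambda>s. \<phi> (?t + s) (p $ YC)) has_vector_derivative D) (at 0 within ?S)"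
    by (simp add: S o_def has_real_derivative_iff_has_vector_derivative)
  then have "((\<lambda>s. f (p + s *\<^sub>R axis TC 1)) has_vector_derivative D) (at 0 within ?S)"
    by (rule has_vector_derivative_transform[rotated -1]) (use p in \<open>auto simp: f axis_def\<close>)
  \<comment> \<open>For t = t0 the parameter interval lies on one side of 0. It still accumulates at
    0, so the one-sided derivative is unique.\<close>
  moreover have "at 0 within ?S \<noteq> bot"
    unfolding S using p by (simp add: trivial_limit_within spacetime_domain_def)
  ultimately show ?thesis
    unfolding partial_deriv_def by (rule vector_derivative_within[rotated])
qed

lemma partial_deriv_YC:
  fixes p :: "real^('n::finite coord)"
  assumes p: "p \<in> spacetime_domain t0"
    and f: "\<And>q. q \<in> spacetime_domain t0 \<Longrightarrow> f q = \<phi> (q $ TC) (q $ YC)"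
    and D: "((\<phi> (p $ TC)) has_real_derivative D) (at (p $ YC))"
  shows "partial_deriv (spacetime_domain t0) YC f p = D"
proof -
  have S: "{s. p + s *\<^sub>R axis YC 1 \<in> spacetime_domain t0} = UNIV"
    using p by (auto simp: spacetime_domain_def axis_def)
  have "((\<phi> (p $ TC)) \<circ> (+) (p $ YC) has_real_derivative D * 1) (at 0)"
    by (rule DERIV_chain) (use D in \<open>auto intro!: derivative_eq_intros\<close>)
  moreover have "(\<phi> (p $ TC)) \<circ> (+) (p $ YC) = (\<lambda>s. f (p + s *\<^sub>R axis YC 1))"
  proof
    fix s
    have "p + s *\<^sub>R axis YC 1 \<in> spacetime_domain t0"
      using S by blast
    then show "((\<phi> (p $ TC)) \<circ> (+) (p $ YC)) s = f (p + s *\<^sub>R axis YC 1)"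
      by (simp add: f) (simp add: axis_def)
  qed
  ultimately show ?thesis
    unfolding partial_deriv_def S by (simp add: has_real_derivative_iff_has_vector_derivative vector_derivative_at)
qed

lemma partial_deriv_XC:
  fixes p :: "real^('n::finite coord)"
  assumes p: "p \<in> spacetime_domain t0"
    and f: "\<And>q. q \<in> spacetime_domain t0 \<Longrightarrow> f q = \<phi> (q $ TC) (q $ YC)"
  shows "partial_deriv (spacetime_domain t0) (XC I) f p = 0"
proof -
  have S: "{s. p + s *\<^sub>R axis (XC I) 1 \<in> spacetime_domain t0} = UNIV"
    using p by (auto simp: spacetime_domain_def axis_def)
  have "(\<lambda>s. f (p + s *\<^sub>R axis (XC I) 1)) = (\<lambda>s. \<phi> (p $ TC) (p $ YC))"
  proof
    fix s
    have "p + s *\<^sub>R axis (XC I) 1 \<in> spacetime_domain t0"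
      using S by blast
    then show "f (p + s *\<^sub>R axis (XC I) 1) = \<phi> (p $ TC) (p $ YC)"
      by (simp add: f) (simp add: axis_def)
  qed
  then show ?thesis
    unfolding partial_deriv_def S by simp
qed

text \<open>Gives names to the partial derivatives of the metric coefficients. \<open>Gty\<close>
  serves as derivative of \<open>Gt\<close> in y and of \<open>Gy\<close> in t, which builds in the
  symmetry of second derivatives.\<close>

locale gowdy_partials = gowdy_spacetime t0 A G L h
  for t0 :: real and A :: "real^'n::finite^'n" and G L h +
  fixes Gt Gy Gtt Gty Gyy :: "real \<Rightarrow> real \<Rightarrow> real^'n^'n" and Lt Ly ht hy :: "real \<Rightarrow> real \<Rightarrow> real"
  assumes Gt: "\<And>t y. t \<in> {0<..t0} \<Longrightarrow> ((\<lambda>s. G s y) has_vector_derivative Gt t y) (at t within {0<..t0})"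
    and Gy: "\<And>t y. t \<in> {0<..t0} \<Longrightarrow> (G t has_vector_derivative Gy t y) (at y)"
    and Gtt: "\<And>t y. t \<in> {0<..t0} \<Longrightarrow> ((\<lambda>s. Gt s y) has_vector_derivative Gtt t y) (at t within {0<..t0})"
    and Gty: "\<And>t y. t \<in> {0<..t0} \<Longrightarrow> (Gt t has_vector_derivative Gty t y) (at y)"
    and Gyt: "\<And>t y. t \<in> {0<..t0} \<Longrightarrow> ((\<lambda>s. Gy s y) has_vector_derivative Gty t y) (at t within {0<..t0})"
    and Gyy: "\<And>t y. t \<in> {0<..t0} \<Longrightarrow> (Gy t has_vector_derivative Gyy t y) (at y)"
    and cont_Gtt: "continuous_on ({0<..t0} \<times> UNIV) (\<lambda>(t, y). Gtt t y)"
    and cont_Gty: "continuous_on ({0<..t0} \<times> UNIV) (\<lambda>(t, y). Gty t y)"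
    and cont_Gyy: "continuous_on ({0<..t0} \<times> UNIV) (\<lambda>(t, y). Gyy t y)"
    and cont_Gt: "continuous_on ({0<..t0} \<times> UNIV) (\<lambda>(t, y). Gt t y)"
    and cont_Gy: "continuous_on ({0<..t0} \<times> UNIV) (\<lambda>(t, y). Gy t y)"
    and Lt: "\<And>t y. t \<in> {0<..t0} \<Longrightarrow> ((\<lambda>s. L s y) has_real_derivative Lt t y) (at t within {0<..t0})"
    and Ly: "\<And>t y. t \<in> {0<..t0} \<Longrightarrow> (L t has_real_derivative Ly t y) (at y)"
    and ht: "\<And>t y. t \<in> {0<..t0} \<Longrightarrow> ((\<lambda>s. h s y) has_real_derivative ht t y) (at t within {0<..t0})"
    and hy: "\<And>t y. t \<in> {0<..t0} \<Longrightarrow> (h t has_real_derivative hy t y) (at y)"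
begin

abbreviation "sdom \<equiv> spacetime_domain t0 :: (real^('n coord)) set"
abbreviation "met \<equiv> gowdy_metric G L h"
abbreviation "Gi t y \<equiv> matrix_inv (G t y)"

lemma domD: "p \<in> sdom \<Longrightarrow> p $ TC \<in> {0<..t0}"
  by (simp add: spacetime_domain_def)

lemma invertible_G: "t \<in> {0<..t0} \<Longrightarrow> invertible (G t y)"
  using invertible_posdef posdef_G by blast

lemma entry_derivs:
  assumes "t \<in> {0<..t0}"
  shows "((\<lambda>s. G s y $ I $ J) has_real_derivative Gt t y $ I $ J) (at t within {0<..t0})"
    "((\<lambda>z. G t z $ I $ J) has_real_derivative Gy t y $ I $ J) (at y)"
    "((\<lambda>s. Gt s y $ I $ J) has_real_derivative Gtt t y $ I $ J) (at t within {0<..t0})"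
    "((\<lambda>z. Gy t z $ I $ J) has_real_derivative Gyy t y $ I $ J) (at y)"
  using assms unfolding has_real_derivative_iff_has_vector_derivative
  by (auto intro!: bounded_linear.has_vector_derivative[OF bounded_linear_vec_nth] Gt Gy Gtt Gyy)

section \<open>Christoffel symbols and fiber components of the Ricci tensor\<close>

lemma partial_deriv_met:
  assumes "p \<in> sdom"
  shows "partial_deriv sdom TC (\<lambda>q. met q $ i $ j) p = (case (i, j) of
        (XC I, XC J) \<Rightarrow> Gt (p $ TC) (p $ YC) $ I $ J
      | (TC, TC) \<Rightarrow> - 2 * L (p $ TC) (p $ YC) * Lt (p $ TC) (p $ YC)
      | (YC, YC) \<Rightarrow> ht (p $ TC) (p $ YC)
      | _ \<Rightarrow> 0)"
    and "partial_deriv sdom YC (\<lambda>q. met q $ i $ j) p = (case (i, j) of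
        (XC I, XC J) \<Rightarrow> Gy (p $ TC) (p $ YC) $ I $ J
      | (TC, TC) \<Rightarrow> - 2 * L (p $ TC) (p $ YC) * Ly (p $ TC) (p $ YC)
      | (YC, YC) \<Rightarrow> hy (p $ TC) (p $ YC)
      | _ \<Rightarrow> 0)"
    and "partial_deriv sdom (XC K) (\<lambda>q. met q $ i $ j) p = 0"
proof -
  define \<phi> where "\<phi> t y = (case (i, j) of
        (XC I, XC J) \<Rightarrow> G t y $ I $ J
      | (TC, TC) \<Rightarrow> - (L t y)\<^sup>2
      | (YC, YC) \<Rightarrow> h t y
      | _ \<Rightarrow> 0)" for t y
  have \<phi>: "met q $ i $ j = \<phi> (q $ TC) (q $ YC)" for q
    by (simp add: gowdy_metric_def \<phi>_def)
  note t = domD[OF assms]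
  show "partial_deriv sdom (XC K) (\<lambda>q. met q $ i $ j) p = 0"
    by (rule partial_deriv_XC[where \<phi>=\<phi>, OF assms \<phi>])
  show "partial_deriv sdom TC (\<lambda>q. met q $ i $ j) p = (case (i, j) of
        (XC I, XC J) \<Rightarrow> Gt (p $ TC) (p $ YC) $ I $ J
      | (TC, TC) \<Rightarrow> - 2 * L (p $ TC) (p $ YC) * Lt (p $ TC) (p $ YC)
      | (YC, YC) \<Rightarrow> ht (p $ TC) (p $ YC)
      | _ \<Rightarrow> 0)"
    by (rule partial_deriv_TC[where \<phi>=\<phi>, OF assms \<phi>], unfold \<phi>_def, cases i; cases j)
      (use t in \<open>auto intro!: derivative_eq_intros Lt ht entry_derivs\<close>)
  show "partial_deriv sdom YC (\<lambda>q. met q $ i $ j) p = (case (i, j) of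
        (XC I, XC J) \<Rightarrow> Gy (p $ TC) (p $ YC) $ I $ J
      | (TC, TC) \<Rightarrow> - 2 * L (p $ TC) (p $ YC) * Ly (p $ TC) (p $ YC)
      | (YC, YC) \<Rightarrow> hy (p $ TC) (p $ YC)
      | _ \<Rightarrow> 0)"
    by (rule partial_deriv_YC[where \<phi>=\<phi>, OF assms \<phi>], unfold \<phi>_def, cases i; cases j)
      (use t in \<open>auto intro!: derivative_eq_intros Ly hy entry_derivs\<close>)
qed

lemma matrix_inv_met:
  assumes "p \<in> sdom"
  shows "matrix_inv (met p) $ i $ j = (case (i, j) of
        (XC I, XC J) \<Rightarrow> Gi (p $ TC) (p $ YC) $ I $ J
      | (TC, TC) \<Rightarrow> - 1 / (L (p $ TC) (p $ YC))\<^sup>2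
      | (YC, YC) \<Rightarrow> 1 / h (p $ TC) (p $ YC)
      | _ \<Rightarrow> 0)"
proof -
  define B :: "real^('n coord)^('n coord)" where "B = (\<chi> i j. (case (i, j) of
        (XC I, XC J) \<Rightarrow> Gi (p $ TC) (p $ YC) $ I $ J
      | (TC, TC) \<Rightarrow> - 1 / (L (p $ TC) (p $ YC))\<^sup>2
      | (YC, YC) \<Rightarrow> 1 / h (p $ TC) (p $ YC)
      | _ \<Rightarrow> 0))"
  note t = domD[OF assms]
  have GG: "(\<Sum>K\<in>UNIV. G (p $ TC) (p $ YC) $ I $ K * Gi (p $ TC) (p $ YC) $ K $ J) = (if I = J then 1 else 0)" for I J
    using matrix_inv_cancel(1)[OF invertible_G[OF t, of "p $ YC"]]
    by (simp add: matrix_matrix_mult_def mat_def vec_eq_iff)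
  have "(met p ** B) $ i $ j = mat 1 $ i $ j" for i j
    using pos_L[OF t, of "p $ YC"] pos_h[OF t, of "p $ YC"]
    by (cases i; cases j) (auto simp: matrix_matrix_mult_def mat_def sum_coord B_def gowdy_metric_def GG)
  then have "matrix_inv (met p) = B"
    by (intro matrix_inv_eqI) (simp add: vec_eq_iff)
  then show ?thesis
    by (simp add: B_def)
qed

abbreviation "\<Gamma> \<equiv> christoffel sdom met"

text \<open>The metric has no cross terms between x and (t, y) and does not depend on x, so symbols
  with an odd number of fiber indices vanish. The others listed are those that enter the fiber
  components of the Ricci tensor.\<close>

lemma christoffel_met:
  assumes "p \<in> sdom"
  defines "t \<equiv> p $ TC" and "y \<equiv> p $ YC"
  shows "\<Gamma> TC (XC I) (XC J) p = Gt t y $ I $ J / (2 * (L t y)\<^sup>2)"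
    and "\<Gamma> YC (XC I) (XC J) p = - (Gy t y $ I $ J) / (2 * h t y)"
    and "\<Gamma> (XC K) (XC I) (XC J) p = 0"
    and "\<Gamma> TC (XC I) TC p = 0" and "\<Gamma> TC (XC I) YC p = 0"
    and "\<Gamma> YC (XC I) TC p = 0" and "\<Gamma> YC (XC I) YC p = 0"
    and "\<Gamma> (XC K) (XC I) TC p = (\<Sum>M\<in>UNIV. Gi t y $ K $ M * Gt t y $ I $ M) / 2"
    and "\<Gamma> (XC K) (XC I) YC p = (\<Sum>M\<in>UNIV. Gi t y $ K $ M * Gy t y $ I $ M) / 2"
    and "\<Gamma> TC TC TC p = Lt t y / L t y" and "\<Gamma> TC TC YC p = Ly t y / L t y"
    and "\<Gamma> YC YC TC p = ht t y / (2 * h t y)" and "\<Gamma> YC YC YC p = hy t y / (2 * h t y)"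
  using pos_L[OF domD[OF assms(1)], of "p $ YC"] pos_h[OF domD[OF assms(1)], of "p $ YC"]
  by (simp_all add: christoffel_def sum_coord matrix_inv_met[OF assms(1)] partial_deriv_met[OF assms(1)]
      t_def y_def field_simps power2_eq_square)

lemma at_within_nontrivial: "t \<in> {0<..t0} \<Longrightarrow> at t within {0<..t0} \<noteq> bot"
  by (simp add: trivial_limit_within)

lemma transpose_Gt:
  assumes "t \<in> {0<..t0}"
  shows "transpose (Gt t y) = Gt t y"
proof -
  have "((\<lambda>s. transpose (G s y)) has_vector_derivative transpose (Gt t y)) (at t within {0<..t0})"
    by (rule bounded_linear.has_vector_derivative[OF bounded_linear_transpose Gt[OF assms]])
  then have "((\<lambda>s. G s y) has_vector_derivative transpose (Gt t y)) (at t within {0<..t0})"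
    by (rule has_vector_derivative_transform[OF assms, rotated]) (simp add: symmetric_G)
  then show ?thesis
    using Gt[OF assms] vector_derivative_unique_within[OF at_within_nontrivial[OF assms]] by blast
qed

lemma transpose_Gy:
  assumes "t \<in> {0<..t0}"
  shows "transpose (Gy t y) = Gy t y"
proof -
  have "((\<lambda>z. transpose (G t z)) has_vector_derivative transpose (Gy t y)) (at y)"
    by (rule bounded_linear.has_vector_derivative[OF bounded_linear_transpose Gy[OF assms]])
  then have "(G t has_vector_derivative transpose (Gy t y)) (at y)"
    by (simp add: symmetric_G[OF assms])
  then show ?thesis
    using Gy[OF assms] vector_derivative_unique_at by blast
qed

text \<open>In the t-part, the contracted symbols contribute trace / 2 + Lt / L + ht / (2 h), and
  differentiating 1 / (2 L^2) contributes - 2 Lt / L, which turns the sign of Lt / L. The y-part is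
  similar, with the sign of hy / (2 h) turned by the derivative of 1 / (2 h).\<close>

lemma ricci_met:
  assumes "p \<in> sdom"
  defines "t \<equiv> p $ TC" and "y \<equiv> p $ YC"
  shows "ricci sdom met (XC I) (XC J) p =
    ((1 / (2 * (L t y)\<^sup>2)) *\<^sub>R (Gtt t y - Gt t y ** Gi t y ** Gt t y
       + (trace (Gi t y ** Gt t y) / 2 - Lt t y / L t y + ht t y / (2 * h t y)) *\<^sub>R Gt t y)
     - (1 / (2 * h t y)) *\<^sub>R (Gyy t y - Gy t y ** Gi t y ** Gy t y
       + (trace (Gi t y ** Gy t y) / 2 + Ly t y / L t y - hy t y / (2 * h t y)) *\<^sub>R Gy t y)) $ I $ J"
proof -
  note t = domD[OF assms(1), folded t_def]
  have pos: "L t y > 0" "h t y > 0"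
    using pos_L[OF t] pos_h[OF t] by auto
  have symm: "M $ i $ j = M $ j $ i" if "transpose M = M" for M :: "real^'n^'n" and i j
    using that by (metis (no_types) transpose_def vec_lambda_beta)
  have d1: "partial_deriv sdom TC (\<Gamma> TC (XC I) (XC J)) p =
      (Gtt t y $ I $ J * (2 * (L t y)\<^sup>2) - Gt t y $ I $ J * (4 * L t y * Lt t y)) / (2 * (L t y)\<^sup>2)\<^sup>2"
    by (rule partial_deriv_TC[where \<phi>="\<lambda>t y. Gt t y $ I $ J / (2 * (L t y)\<^sup>2)", OF assms(1) christoffel_met(1)])
      (use pos t in \<open>auto intro!: derivative_eq_intros entry_derivs Lt simp: t_def y_def power2_eq_square\<close>)
  have d2: "partial_deriv sdom YC (\<Gamma> YC (XC I) (XC J)) p =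
      - ((Gyy t y $ I $ J * (2 * h t y) - Gy t y $ I $ J * (2 * hy t y)) / (2 * h t y)\<^sup>2)"
    by (rule partial_deriv_YC[where \<phi>="\<lambda>t y. - (Gy t y $ I $ J) / (2 * h t y)", OF assms(1) christoffel_met(2)])
      (use pos t in \<open>auto intro!: derivative_eq_intros entry_derivs hy simp: t_def y_def power2_eq_square\<close>)
  have d3: "partial_deriv sdom (XC K) (\<Gamma> (XC K) (XC I) (XC J)) p = 0" for K
    by (rule partial_deriv_XC[where \<phi>="\<lambda>_ _. 0", OF assms(1) christoffel_met(3)])
  have d4: "partial_deriv sdom (XC J) (\<Gamma> k (XC I) k) p = 0" for k
    by (rule partial_deriv_XC[where \<phi>="\<lambda>_ _. 0", OF assms(1)]) (cases k; simp add: christoffel_met)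
  define a where "a = Gi t y"
  note \<Gamma> = christoffel_met[OF assms(1), folded t_def y_def, folded a_def]
  have sym_a: "a $ i $ j = a $ j $ i" for i j
    by (rule symm) (simp add: a_def transpose_matrix_inv[OF invertible_G[OF t]] symmetric_G[OF t])
  have symt: "Gt t y $ i $ j = Gt t y $ j $ i" and symy: "Gy t y $ i $ j = Gy t y $ j $ i" for i j
    by (rule symm, simp add: transpose_Gt[OF t] transpose_Gy[OF t])+
  have tr: "(\<Sum>K\<in>UNIV. \<Gamma> (XC K) (XC K) TC p) = trace (a ** Gt t y) / 2"
    "(\<Sum>K\<in>UNIV. \<Gamma> (XC K) (XC K) YC p) = trace (a ** Gy t y) / 2"
    using symt symy by (simp_all add: \<Gamma> trace_def matrix_matrix_mult_def sum_divide_distrib)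
  \<comment> \<open>Two index patterns of the same product M G^-1 M, matched by the symmetry of M
    and of G^-1.\<close>
  have quad: "(\<Sum>K\<in>UNIV. M $ J $ K * (\<Sum>m\<in>UNIV. a $ K $ m * M $ I $ m)) = (M ** a ** M) $ I $ J"
    "(\<Sum>K\<in>UNIV. (\<Sum>m\<in>UNIV. a $ K $ m * M $ J $ m) * M $ I $ K) = (M ** a ** M) $ I $ J"
    if M: "\<And>i j. M $ i $ j = M $ j $ i" for M :: "real^'n^'n"
  proof -
    have 1: "(M ** a ** M) $ I $ J = (\<Sum>K\<in>UNIV. \<Sum>m\<in>UNIV. M $ I $ m * a $ m $ K * M $ K $ J)"
      by (simp add: matrix_matrix_mult_def sum_distrib_right)
    show "(\<Sum>K\<in>UNIV. M $ J $ K * (\<Sum>m\<in>UNIV. a $ K $ m * M $ I $ m)) = (M ** a ** M) $ I $ J"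
      unfolding 1 sum_distrib_left by (intro sum.cong refl) (metis (no_types) M sym_a mult.commute mult.assoc)
    have "(\<Sum>K\<in>UNIV. (\<Sum>m\<in>UNIV. a $ K $ m * M $ J $ m) * M $ I $ K) =
        (\<Sum>m\<in>UNIV. \<Sum>K\<in>UNIV. M $ I $ K * a $ K $ m * M $ m $ J)"
      unfolding sum_distrib_right by (subst sum.swap, intro sum.cong refl) (metis (no_types) M mult.commute mult.assoc)
    then show "(\<Sum>K\<in>UNIV. (\<Sum>m\<in>UNIV. a $ K $ m * M $ J $ m) * M $ I $ K) = (M ** a ** M) $ I $ J"
      unfolding 1 .
  qed
  have quad1: "(\<Sum>K\<in>UNIV. \<Gamma> TC (XC J) (XC K) p * \<Gamma> (XC K) (XC I) TC p) = (Gt t y ** a ** Gt t y) $ I $ J / (4 * (L t y)\<^sup>2)"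
    "(\<Sum>K\<in>UNIV. \<Gamma> (XC K) (XC J) TC p * \<Gamma> TC (XC I) (XC K) p) = (Gt t y ** a ** Gt t y) $ I $ J / (4 * (L t y)\<^sup>2)"
    "(\<Sum>K\<in>UNIV. \<Gamma> YC (XC J) (XC K) p * \<Gamma> (XC K) (XC I) YC p) = - (Gy t y ** a ** Gy t y) $ I $ J / (4 * h t y)"
    "(\<Sum>K\<in>UNIV. \<Gamma> (XC K) (XC J) YC p * \<Gamma> YC (XC I) (XC K) p) = - (Gy t y ** a ** Gy t y) $ I $ J / (4 * h t y)"
    subgoal unfolding quad(1)[OF symt, symmetric] by (simp add: \<Gamma> sum_divide_distrib[where r="4 * (L t y)\<^sup>2"])
    subgoal unfolding quad(2)[OF symt, symmetric] by (simp add: \<Gamma> sum_divide_distrib[where r="4 * (L t y)\<^sup>2"])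
    subgoal unfolding quad(1)[OF symy, symmetric] by (simp add: \<Gamma> sum_divide_distrib[where r="4 * h t y"] sum_negf)
    subgoal unfolding quad(2)[OF symy, symmetric] by (simp add: \<Gamma> sum_divide_distrib[where r="4 * h t y"] sum_negf)
    done
  \<comment> \<open>The parity of fiber indices leaves these terms. In the last double sum one of k,
    l is a fiber index and the other is t or y, which gives four sums.\<close>
  have main: "ricci sdom met (XC I) (XC J) p =
      partial_deriv sdom TC (\<Gamma> TC (XC I) (XC J)) p + partial_deriv sdom YC (\<Gamma> YC (XC I) (XC J)) p
      + (\<Gamma> TC TC TC p + \<Gamma> YC YC TC p + (\<Sum>K\<in>UNIV. \<Gamma> (XC K) (XC K) TC p)) * \<Gamma> TC (XC I) (XC J) p
      + (\<Gamma> TC TC YC p + \<Gamma> YC YC YC p + (\<Sum>K\<in>UNIV. \<Gamma> (XC K) (XC K) YC p)) * \<Gamma> YC (XC I) (XC J) p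
      - (\<Sum>K\<in>UNIV. \<Gamma> TC (XC J) (XC K) p * \<Gamma> (XC K) (XC I) TC p)
      - (\<Sum>K\<in>UNIV. \<Gamma> (XC K) (XC J) TC p * \<Gamma> TC (XC I) (XC K) p)
      - (\<Sum>K\<in>UNIV. \<Gamma> YC (XC J) (XC K) p * \<Gamma> (XC K) (XC I) YC p)
      - (\<Sum>K\<in>UNIV. \<Gamma> (XC K) (XC J) YC p * \<Gamma> YC (XC I) (XC K) p)"
    unfolding ricci_def sum_coord d3 d4 christoffel_met(3-7)[OF assms(1)]
    by (simp add: sum.distrib sum_distrib_right distrib_right)
  show ?thesis
    unfolding main d1 d2 tr quad1 unfolding \<Gamma> a_def[symmetric]
    using pos by (simp add: field_simps power2_eq_square)
qed

end

subsection \<open>From Ricci-flatness to the wave equation\<close>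

context gowdy_partials
begin

definition X where "X t y = Gi t y ** Gt t y"
definition Y where "Y t y = Gi t y ** Gy t y"
definition Xt where "Xt t y = Gi t y ** Gtt t y - X t y ** X t y"
text \<open>\<open>Xy\<close> and \<open>Yt\<close> contain the same mixed derivative of G, so Yt =
  Xy + Y X - X Y. This zero-curvature identity becomes the formula for V_\<tau>.\<close>

definition Xy where "Xy t y = Gi t y ** Gty t y - Y t y ** X t y"
definition Yt where "Yt t y = Gi t y ** Gty t y - X t y ** Y t y"
definition Yy where "Yy t y = Gi t y ** Gyy t y - Y t y ** Y t y"

lemma logarithmic_derivs:
  assumes t: "t \<in> {0<..t0}"
  shows "((\<lambda>s. X s y) has_vector_derivative Xt t y) (at t within {0<..t0})"
    "(X t has_vector_derivative Xy t y) (at y)"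
    "((\<lambda>s. Y s y) has_vector_derivative Yt t y) (at t within {0<..t0})"
    "(Y t has_vector_derivative Yy t y) (at y)"
proof -
  have Gi_t: "((\<lambda>s. Gi s y) has_vector_derivative - (Gi t y ** Gt t y ** Gi t y)) (at t within {0<..t0})"
    by (rule has_vector_derivative_matrix_inv[OF Gt[OF t] t]) (rule invertible_G)
  have Gi_y: "((\<lambda>z. Gi t z) has_vector_derivative - (Gi t y ** Gy t y ** Gi t y)) (at y)"
    by (rule has_vector_derivative_matrix_inv[OF Gy[OF t]]) (auto intro: invertible_G[OF t])
  show "((\<lambda>s. X s y) has_vector_derivative Xt t y) (at t within {0<..t0})"
    using matrix_mult.has_vector_derivative[OF Gi_t Gtt[OF t]]
    by (simp add: X_def Xt_def matrix_mult.minus_left matrix_mul_assoc)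
  show "(X t has_vector_derivative Xy t y) (at y)"
    using matrix_mult.has_vector_derivative[OF Gi_y Gty[OF t]]
    by (simp add: X_def[abs_def] Xy_def Y_def X_def matrix_mult.minus_left matrix_mul_assoc)
  show "((\<lambda>s. Y s y) has_vector_derivative Yt t y) (at t within {0<..t0})"
    using matrix_mult.has_vector_derivative[OF Gi_t Gyt[OF t]]
    by (simp add: X_def Y_def Yt_def matrix_mult.minus_left matrix_mul_assoc)
  show "(Y t has_vector_derivative Yy t y) (at y)"
    using matrix_mult.has_vector_derivative[OF Gi_y Gyy[OF t]]
    by (simp add: Y_def[abs_def] Yy_def Y_def matrix_mult.minus_left matrix_mul_assoc)
qed

text \<open>Jacobi's formula applied to det G = t^N, with the derivative of the power computed
  directly.\<close>

lemma trace_X: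
  assumes t: "t \<in> {0<..t0}"
  shows "trace (X t y) = real CARD('n) / t"
proof -
  have "((\<lambda>s. det (G s y)) has_real_derivative t ^ CARD('n) * trace (X t y)) (at t within {0<..t0})"
    using has_real_derivative_det[OF Gt[OF t] invertible_G[OF t]] by (simp add: X_def areal[OF t])
  then have "((\<lambda>s. s ^ CARD('n)) has_vector_derivative t ^ CARD('n) * trace (X t y)) (at t within {0<..t0})"
    unfolding has_real_derivative_iff_has_vector_derivative
    by (rule has_vector_derivative_transform[OF t, rotated]) (simp add: areal)
  moreover have "((\<lambda>s. s ^ CARD('n)) has_real_derivative real CARD('n) * t ^ (CARD('n) - 1)) (at t within {0<..t0})"
    by (auto intro!: derivative_eq_intros)
  ultimately have "t ^ CARD('n) * trace (X t y) = real CARD('n) * t ^ (CARD('n) - 1)"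
    unfolding has_real_derivative_iff_has_vector_derivative
    by (rule vector_derivative_unique_within[OF at_within_nontrivial[OF t]])
  moreover have "t ^ CARD('n) = t * t ^ (CARD('n) - 1)"
    by (metis One_nat_def Suc_pred power_Suc zero_less_card_finite)
  ultimately show ?thesis
    using t by (simp add: field_simps)
qed

lemma trace_Y:
  assumes t: "t \<in> {0<..t0}"
  shows "trace (Y t y) = 0"
proof -
  have "((\<lambda>z. det (G t z)) has_real_derivative t ^ CARD('n) * trace (Y t y)) (at y)"
    using has_real_derivative_det[OF Gy[OF t] invertible_G[OF t]] by (simp add: Y_def areal[OF t])
  then have "((\<lambda>z. t ^ CARD('n)) has_real_derivative t ^ CARD('n) * trace (Y t y)) (at y)"
    by (simp add: areal[OF t])
  then have "t ^ CARD('n) * trace (Y t y) = 0"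
    using DERIV_unique DERIV_const by blast
  then show ?thesis
    using t by simp
qed

lemma trace_Xt:
  assumes t: "t \<in> {0<..t0}"
  shows "trace (Xt t y) = - real CARD('n) / t\<^sup>2"
proof -
  have "((\<lambda>s. trace (X s y)) has_vector_derivative trace (Xt t y)) (at t within {0<..t0})"
    by (rule bounded_linear.has_vector_derivative[OF bounded_linear_trace logarithmic_derivs(1)[OF t]])
  then have "((\<lambda>s. real CARD('n) / s) has_vector_derivative trace (Xt t y)) (at t within {0<..t0})"
    by (rule has_vector_derivative_transform[OF t, rotated]) (simp add: trace_X)
  moreover have "((\<lambda>s. real CARD('n) / s) has_real_derivative - real CARD('n) / t\<^sup>2) (at t within {0<..t0})"
    using t by (auto intro!: derivative_eq_intros simp: power2_eq_square)
  ultimately show ?thesis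
    unfolding has_real_derivative_iff_has_vector_derivative
    by (rule vector_derivative_unique_within[OF at_within_nontrivial[OF t]])
qed

lemma trace_Yy:
  assumes t: "t \<in> {0<..t0}"
  shows "trace (Yy t y) = 0"
proof -
  have "((\<lambda>z. trace (Y t z)) has_vector_derivative trace (Yy t y)) (at y)"
    by (rule bounded_linear.has_vector_derivative[OF bounded_linear_trace logarithmic_derivs(4)[OF t]])
  then have "((\<lambda>z. 0) has_vector_derivative trace (Yy t y)) (at y)"
    by (simp add: trace_Y[OF t])
  then show ?thesis
    using vector_derivative_unique_at has_vector_derivative_const by blast
qed

text \<open>The fiber Ricci equation multiplied by 2 L^2 G^-1: the expressions Gtt - Gt G^-1 Gt and
  Gyy - Gy G^-1 Gy become \<open>Xt\<close> and \<open>Yy\<close>. The term N / (2 t) is half the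
  trace of X.\<close>

lemma ricci_flat_matrix:
  assumes t: "t \<in> {0<..t0}"
  shows "Xt t y + (real CARD('n) / (2 * t) - Lt t y / L t y + ht t y / (2 * h t y)) *\<^sub>R X t y =
    ((L t y)\<^sup>2 / h t y) *\<^sub>R (Yy t y + (Ly t y / L t y - hy t y / (2 * h t y)) *\<^sub>R Y t y)"
proof -
  \<comment> \<open>Any point over (t, y) would do; its fiber coordinates are set to 0.\<close>
  define p :: "real^('n coord)" where "p = (\<chi> i. case i of TC \<Rightarrow> t | YC \<Rightarrow> y | XC _ \<Rightarrow> 0)"
  have p: "p \<in> sdom" "p $ TC = t" "p $ YC = y"
    using t by (auto simp: p_def spacetime_domain_def)
  have pos: "L t y > 0" "h t y > 0"
    using pos_L[OF t] pos_h[OF t] by auto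
  define a where "a = real CARD('n) / (2 * t) - Lt t y / L t y + ht t y / (2 * h t y)"
  define b where "b = Ly t y / L t y - hy t y / (2 * h t y)"
  have "(1 / (2 * (L t y)\<^sup>2)) *\<^sub>R (Gtt t y - Gt t y ** Gi t y ** Gt t y + a *\<^sub>R Gt t y)
     - (1 / (2 * h t y)) *\<^sub>R (Gyy t y - Gy t y ** Gi t y ** Gy t y + b *\<^sub>R Gy t y) = 0"
    unfolding vec_eq_iff zero_index
    using ricci_flat[OF p(1)] ricci_met[OF p(1)] trace_X[OF t, of y] trace_Y[OF t, of y]
    by (simp add: p(2,3) X_def Y_def a_def b_def mult.commute[of t 2])
  then have "Gi t y ** ((1 / (2 * (L t y)\<^sup>2)) *\<^sub>R (Gtt t y - Gt t y ** Gi t y ** Gt t y + a *\<^sub>R Gt t y)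
     - (1 / (2 * h t y)) *\<^sub>R (Gyy t y - Gy t y ** Gi t y ** Gy t y + b *\<^sub>R Gy t y)) = 0"
    by (simp add: matrix_mult.zero_right)
  then have eq: "(1 / (2 * (L t y)\<^sup>2)) *\<^sub>R (Xt t y + a *\<^sub>R X t y) = (1 / (2 * h t y)) *\<^sub>R (Yy t y + b *\<^sub>R Y t y)"
    by (simp add: X_def Y_def Xt_def Yy_def matrix_mult.add_right matrix_mult.diff_right matrix_mult.scaleR_right matrix_mul_assoc)
  have "Xt t y + a *\<^sub>R X t y = (2 * (L t y)\<^sup>2) *\<^sub>R ((1 / (2 * (L t y)\<^sup>2)) *\<^sub>R (Xt t y + a *\<^sub>R X t y))"
    using pos by simp
  also have "\<dots> = ((L t y)\<^sup>2 / h t y) *\<^sub>R (Yy t y + b *\<^sub>R Y t y)"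
    unfolding eq using pos by simp
  finally show ?thesis
    by (simp add: a_def b_def)
qed

text \<open>The traces of \<open>Y\<close> and \<open>Yy\<close> vanish, so the trace of the right
  side of \<open>ricci_flat_matrix\<close> is 0. With trace X = N / t and trace Xt = - N / t^2 this
  determines the coefficient of X.\<close>

lemma constraint:
  assumes t: "t \<in> {0<..t0}"
  shows "real CARD('n) / (2 * t) - Lt t y / L t y + ht t y / (2 * h t y) = 1 / t"
proof -
  define a where "a = real CARD('n) / (2 * t) - Lt t y / L t y + ht t y / (2 * h t y)"
  have "trace (Xt t y + a *\<^sub>R X t y) = 0"
    unfolding a_def ricci_flat_matrix[OF t]
    by (simp add: trace_add trace_scaleR trace_Y[OF t] trace_Yy[OF t])
  then have "- real CARD('n) / t\<^sup>2 + a * (real CARD('n) / t) = 0"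
    by (simp add: trace_add trace_scaleR trace_X[OF t] trace_Xt[OF t])
  then have "a = 1 / t"
    using t by (simp add: field_simps power2_eq_square)
  then show ?thesis
    by (simp add: a_def)
qed

text \<open>\<open>gowdy_density\<close> evaluated in the areal gauge: det G = t^N, and N / t is the
  derivative of ln (det G).\<close>

definition dens :: "real \<Rightarrow> real \<Rightarrow> real" where
  "dens t y = inverse (L t y) * sqrt (t ^ CARD('n)) * (real CARD('n) / t) * sqrt (h t y)"

lemma gowdy_density_eq:
  assumes t: "t \<in> {0<..t0}"
  shows "gowdy_density t0 G L h t y = dens t y"
proof -
  have "((\<lambda>s. real CARD('n) * ln s) has_real_derivative real CARD('n) * (1 / t)) (at t within {0<..t0})"
    using t by (auto intro!: derivative_eq_intros)
  then have "((\<lambda>s. real CARD('n) * ln s) has_vector_derivative real CARD('n) / t) (at t within {0<..t0})"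
    by (simp add: has_real_derivative_iff_has_vector_derivative)
  then have "((\<lambda>s. ln (det (G s y))) has_vector_derivative real CARD('n) / t) (at t within {0<..t0})"
    by (rule has_vector_derivative_transform[OF t, rotated]) (simp add: areal ln_realpow)
  then have "vector_derivative (\<lambda>s. ln (det (G s y))) (at t within {0<..t0}) = real CARD('n) / t"
    by (rule vector_derivative_within[OF at_within_nontrivial[OF t]])
  then show ?thesis
    by (simp add: gowdy_density_def dens_def areal[OF t])
qed

lemma dens_pos: "t \<in> {0<..t0} \<Longrightarrow> 0 < dens t y"
  using pos_L[of t y] pos_h[of t y] by (simp add: dens_def)

lemma dens_square:
  assumes "t \<in> {0<..t0}"
  shows "(dens t y)\<^sup>2 = t ^ CARD('n) * (real CARD('n))\<^sup>2 * h t y / (t\<^sup>2 * (L t y)\<^sup>2)"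
  using assms pos_L[OF assms, of y] pos_h[OF assms, of y]
  by (simp add: dens_def power_mult_distrib power_divide power_inverse field_simps)

text \<open>The logarithmic derivative is the coefficient in \<open>constraint\<close> minus 1 / t,
  the latter coming from the factor N / t.\<close>

lemma dens_t:
  assumes t: "t \<in> {0<..t0}"
  shows "((\<lambda>s. dens s y) has_real_derivative 0) (at t within {0<..t0})"
proof -
  have pos: "L t y > 0" "h t y > 0" "t > 0"
    using pos_L[OF t] pos_h[OF t] t by auto
  have tN: "t ^ CARD('n) = t * t ^ (CARD('n) - 1)"
    by (metis One_nat_def Suc_pred power_Suc zero_less_card_finite)
  have sq: "((\<lambda>s. sqrt (s ^ CARD('n))) has_real_derivative sqrt (t ^ CARD('n)) * (real CARD('n) / (2 * t))) (at t within {0<..t0})"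
  proof -
    have "((\<lambda>s. sqrt (s ^ CARD('n))) has_real_derivative real CARD('n) * t ^ (CARD('n) - 1) * (inverse (sqrt (t ^ CARD('n))) / 2)) (at t within {0<..t0})"
      using pos by (auto intro!: derivative_eq_intros)
    moreover have "real CARD('n) * t ^ (CARD('n) - 1) * (inverse (sqrt (t ^ CARD('n))) / 2) = sqrt (t ^ CARD('n)) * (real CARD('n) / (2 * t))"
    proof -
      have "sqrt (t ^ CARD('n)) * sqrt (t ^ CARD('n)) = t * t ^ (CARD('n) - 1)"
        using pos tN by simp
      then show ?thesis
        using pos by (simp add: field_simps)
    qed
    ultimately show ?thesis by metis
  qed
  have sh: "((\<lambda>s. sqrt (h s y)) has_real_derivative sqrt (h t y) * (ht t y / (2 * h t y))) (at t within {0<..t0})"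
    using pos by (auto intro!: derivative_eq_intros ht t simp: field_simps)
  have "((\<lambda>s. dens s y) has_real_derivative dens t y * (real CARD('n) / (2 * t) - Lt t y / L t y + ht t y / (2 * h t y) - 1 / t)) (at t within {0<..t0})"
    unfolding dens_def
    by (rule derivative_eq_intros sq sh Lt[OF t] refl | (use pos in \<open>simp; fail\<close>))+
      (use pos in \<open>simp add: field_simps power2_eq_square\<close>)
  then show ?thesis
    by (simp add: constraint[OF t])
qed

lemma dens_const:
  assumes t: "t \<in> {0<..t0}"
  shows "dens t y = dens t0 y"
proof -
  obtain c where "\<And>t. t \<in> {0<..t0} \<Longrightarrow> dens t y = c"
    using has_field_derivative_zero_constant[of "{0<..t0}" "\<lambda>s. dens s y"] dens_t by auto
  then show ?thesis
    using t t0_pos by simp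
qed

lemma dens_y:
  assumes t: "t \<in> {0<..t0}"
  shows "(dens t has_real_derivative dens t y * (hy t y / (2 * h t y) - Ly t y / L t y)) (at y)"
proof -
  have pos: "L t y > 0" "h t y > 0" "t > 0"
    using pos_L[OF t] pos_h[OF t] t by auto
  have sh: "((\<lambda>z. sqrt (h t z)) has_real_derivative sqrt (h t y) * (hy t y / (2 * h t y))) (at y)"
    using pos by (auto intro!: derivative_eq_intros hy t simp: field_simps)
  show ?thesis
    unfolding dens_def
    by (rule derivative_eq_intros sh Ly[OF t] refl | (use pos in \<open>simp; fail\<close>))+
      (use pos in \<open>simp add: field_simps power2_eq_square\<close>)
qed

text \<open>1 / \<mu> is an integrating factor: Ly / L - hy / (2 h) equals - \<mu>_y / \<mu>, so Yy
  plus this multiple of Y is \<mu> (Y / \<mu>)_y. The remaining h / L^2 is expressed through \<mu>^2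
  by \<open>dens_square\<close>.\<close>

lemma wave_equation:
  assumes t: "t \<in> {0<..t0}"
  shows "((\<lambda>z. (1 / dens t0 z) *\<^sub>R Y t z) has_vector_derivative
    (dens t0 y * t\<^sup>2 / (t ^ CARD('n) * (real CARD('n))\<^sup>2)) *\<^sub>R (Xt t y + (1 / t) *\<^sub>R X t y)) (at y)"
proof -
  have pos: "L t y > 0" "h t y > 0" "t > 0" "dens t y > 0"
    using pos_L[OF t] pos_h[OF t] t dens_pos[OF t] by auto
  define b where "b = Ly t y / L t y - hy t y / (2 * h t y)"
  have "((\<lambda>z. 1 / dens t z) has_real_derivative b / dens t y) (at y)"
    by (rule derivative_eq_intros dens_y[OF t] refl)+
      (use pos in \<open>auto simp: b_def field_simps power2_eq_square\<close>)
  then have "((\<lambda>z. (1 / dens t z) *\<^sub>R Y t z) has_vector_derivative (1 / dens t y) *\<^sub>R Yy t y + (b / dens t y) *\<^sub>R Y t y) (at y)"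
    by (rule has_vector_derivative_scaleR[OF _ logarithmic_derivs(4)[OF t]])
  also have "(1 / dens t y) *\<^sub>R Yy t y + (b / dens t y) *\<^sub>R Y t y = (1 / dens t y) *\<^sub>R (Yy t y + b *\<^sub>R Y t y)"
    by (simp add: scaleR_add_right)
  also have "Yy t y + b *\<^sub>R Y t y = (h t y / (L t y)\<^sup>2) *\<^sub>R (((L t y)\<^sup>2 / h t y) *\<^sub>R (Yy t y + b *\<^sub>R Y t y))"
    using pos by simp
  also have "((L t y)\<^sup>2 / h t y) *\<^sub>R (Yy t y + b *\<^sub>R Y t y) = Xt t y + (1 / t) *\<^sub>R X t y"
    using ricci_flat_matrix[OF t, of y] by (simp add: constraint[OF t] b_def)
  also have "h t y / (L t y)\<^sup>2 = (dens t y)\<^sup>2 * t\<^sup>2 / (t ^ CARD('n) * (real CARD('n))\<^sup>2)"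
    unfolding dens_square[OF t] using pos by simp
  finally show ?thesis
    using pos by (simp add: dens_const[OF t] power2_eq_square mult_ac)
qed

section \<open>Equivariance under the holonomy\<close>

lemma equivariant_Gt:
  assumes t: "t \<in> {0<..t0}"
  shows "Gt t (y + 1) = transpose A ** Gt t y ** A"
proof -
  have "((\<lambda>s. transpose A ** G s y ** A) has_vector_derivative transpose A ** Gt t y ** A) (at t within {0<..t0})"
    by (intro bounded_linear.has_vector_derivative[OF matrix_mult.bounded_linear_left]
        bounded_linear.has_vector_derivative[OF matrix_mult.bounded_linear_right] Gt t)
  then have "((\<lambda>s. G s (y + 1)) has_vector_derivative transpose A ** Gt t y ** A) (at t within {0<..t0})"
    by (rule has_vector_derivative_transform[OF t, rotated]) (rule equivariant_G)
  then show ?thesis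
    using Gt[OF t] vector_derivative_unique_within[OF at_within_nontrivial[OF t]] by blast
qed

lemma equivariant_Gy:
  assumes t: "t \<in> {0<..t0}"
  shows "Gy t (y + 1) = transpose A ** Gy t y ** A"
proof -
  have "((\<lambda>z. transpose A ** G t z ** A) has_vector_derivative transpose A ** Gy t y ** A) (at y)"
    by (intro bounded_linear.has_vector_derivative[OF matrix_mult.bounded_linear_left]
        bounded_linear.has_vector_derivative[OF matrix_mult.bounded_linear_right] Gy t)
  then have 1: "((\<lambda>z. G t (z + 1)) has_vector_derivative transpose A ** Gy t y ** A) (at y)"
    by (simp add: equivariant_G[OF t])
  have "((\<lambda>z. z + 1) has_vector_derivative 1) (at y)"
    by (auto intro!: derivative_eq_intros)
  then have "(G t \<circ> (\<lambda>z. z + 1) has_vector_derivative 1 *\<^sub>R Gy t (y + 1)) (at y)"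
    by (rule vector_diff_chain_at[OF _ Gy[OF t]])
  then show ?thesis
    using vector_derivative_unique_at[OF 1] by (simp add: o_def)
qed

text \<open>Raising an index with G turns an equivariant bilinear form into an equivariant
  endomorphism; the identity is checked after multiplication by \<open>G t (y + 1)\<close>.\<close>

lemma equivariant_quotient:
  assumes t: "t \<in> {0<..t0}" and B: "B (y + 1) = transpose A ** B y ** A"
  shows "Gi t (y + 1) ** B (y + 1) = matrix_inv A ** (Gi t y ** B y) ** A"
proof -
  have A: "invertible A"
    using holonomy_SL invertible_det_nz by fastforce
  note cancel = matrix_inv_cancel_left(2)[OF invertible_G[OF t]]
  have "G t (y + 1) ** (matrix_inv A ** (Gi t y ** B y) ** A) = B (y + 1)"
    by (simp add: equivariant_G[OF t] B matrix_mul_assoc[symmetric] matrix_inv_cancel_left(1)[OF A]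
        matrix_inv_cancel_left(1)[OF invertible_G[OF t]])
  then show ?thesis
    using cancel by metis
qed

lemma cont_G: "continuous_on ({0<..t0} \<times> UNIV) (\<lambda>(t, y). G t y)"
  using smooth_G Ck_on_imp_continuous_on unfolding smooth_on_def by blast

lemma cont_Gi: "continuous_on ({0<..t0} \<times> UNIV) (\<lambda>(t, y). Gi t y)"
  using continuous_on_matrix_inv[OF cont_G] invertible_G by (auto simp: case_prod_unfold)

text \<open>The substitution t = exp (- \<tau>) gives U = - t X and U_\<tau> = t (t X)_t = t^2 (Xt +
  X / t), the combination on the right of \<open>wave_equation\<close>, while t^(- N) becomes exp (N
  \<tau>).\<close>

lemma gowdy_wave:
  assumes t0: "t0 = exp (- \<tau>0)"
  shows "gowdy_wave A \<tau>0 (real CARD('n)) (\<lambda>\<tau>. G (exp (- \<tau>)))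
    (\<lambda>\<tau> y. (- exp (- \<tau>)) *\<^sub>R X (exp (- \<tau>)) y) (\<lambda>\<tau>. Y (exp (- \<tau>)))
    (\<lambda>\<tau> y. (exp (- \<tau>))\<^sup>2 *\<^sub>R Xt (exp (- \<tau>)) y + exp (- \<tau>) *\<^sub>R X (exp (- \<tau>)) y)
    (\<lambda>\<tau> y. (- exp (- \<tau>)) *\<^sub>R Xy (exp (- \<tau>)) y) (dens t0)"
proof -
  have dom: "exp (- \<tau>) \<in> {0<..t0}" if "\<tau> \<ge> \<tau>0" for \<tau>
    using that by (simp add: t0)
  have e: "((\<lambda>s. exp (- s)) has_real_derivative - exp (- \<tau>)) (at \<tau> within S)" for \<tau> :: real and S
    by (auto intro!: derivative_eq_intros)
  have chain: "((\<lambda>s. f (exp (- s))) has_vector_derivative (- exp (- \<tau>)) *\<^sub>R f') (at \<tau> within {\<tau>0..})"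
    if \<tau>: "\<tau> \<ge> \<tau>0" and f: "(f has_vector_derivative f') (at (exp (- \<tau>)) within {0<..t0})"
    for f :: "real \<Rightarrow> real^'n^'n" and f' \<tau>
  proof -
    have "(f has_vector_derivative f') (at (exp (- \<tau>)) within (\<lambda>s. exp (- s)) ` {\<tau>0..})"
      by (rule has_vector_derivative_within_subset[OF f]) (use dom in auto)
    then show ?thesis
      using vector_diff_chain_within[OF e[unfolded has_real_derivative_iff_has_vector_derivative]]
      by (simp add: o_def)
  qed
  have cont: "continuous_on ({\<tau>0..} \<times> UNIV) (\<lambda>p. f (exp (- fst p)) (snd p))"
    if "continuous_on ({0<..t0} \<times> UNIV) (\<lambda>(t, y). f t y)" for f :: "real \<Rightarrow> real \<Rightarrow> real^'n^'n"
  proof -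
    have "continuous_on ({\<tau>0..} \<times> UNIV) (\<lambda>p :: real \<times> real. (exp (- fst p), snd p))"
      by (intro continuous_intros)
    moreover have "(\<lambda>p :: real \<times> real. (exp (- fst p), snd p)) ` ({\<tau>0..} \<times> UNIV) \<subseteq> {0<..t0} \<times> UNIV"
      using dom by auto
    ultimately show ?thesis
      using continuous_on_compose2[OF that] by fastforce
  qed
  note cont_intros = continuous_intros matrix_mult.continuous_on cont[OF cont_G] cont[OF cont_Gi]
    cont[OF cont_Gt] cont[OF cont_Gy] cont[OF cont_Gtt] cont[OF cont_Gty] cont[OF cont_Gyy]
  have t0_mem: "t0 \<in> {0<..t0}"
    using t0_pos by simp
  show ?thesis
  proof
    show "invertible A"
      using holonomy_SL invertible_det_nz by fastforce
    show "continuous_on UNIV (dens t0)"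
      using dens_y[OF t0_mem] by (meson DERIV_isCont continuous_at_imp_continuous_on)
    show "0 < dens t0 y" for y
      by (rule dens_pos[OF t0_mem])
    show "dens t0 (y + 1) = dens t0 y" for y
      by (simp add: dens_def periodic_L[OF t0_mem] periodic_h[OF t0_mem])
  next
    fix \<tau> y assume \<tau>: "\<tau> \<ge> \<tau>0"
    note t = dom[OF \<tau>]
    note GX = matrix_inv_cancel_left(1)[OF invertible_G[OF t]]
    show "smooth_on UNIV (G (exp (- \<tau>)))"
      using smooth_G Ck_on_slice_snd[OF _ t] unfolding smooth_on_def by fastforce
    show "transpose (G (exp (- \<tau>)) y) = G (exp (- \<tau>)) y"
      by (rule symmetric_G[OF t])
    show "G (exp (- \<tau>)) (y + 1) = transpose A ** G (exp (- \<tau>)) y ** A"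
      by (rule equivariant_G[OF t])
    show "(- exp (- \<tau>)) *\<^sub>R X (exp (- \<tau>)) (y + 1) = matrix_inv A ** ((- exp (- \<tau>)) *\<^sub>R X (exp (- \<tau>)) y) ** A"
      using equivariant_quotient[where B="Gt (exp (- \<tau>))", OF t equivariant_Gt[OF t]]
      by (simp add: X_def matrix_mult.scaleR_left matrix_mult.scaleR_right matrix_mult.minus_left matrix_mult.minus_right)
    show "Y (exp (- \<tau>)) (y + 1) = matrix_inv A ** Y (exp (- \<tau>)) y ** A"
      using equivariant_quotient[where B="Gy (exp (- \<tau>))", OF t equivariant_Gy[OF t]] by (simp add: Y_def)
    show "transpose (G (exp (- \<tau>)) y ** ((- exp (- \<tau>)) *\<^sub>R X (exp (- \<tau>)) y)) = G (exp (- \<tau>)) y ** ((- exp (- \<tau>)) *\<^sub>R X (exp (- \<tau>)) y)"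
      by (simp add: X_def GX matrix_mult.scaleR_right matrix_mult.minus_right transpose_minus transpose_scalar transpose_Gt[OF t])
    show "transpose (G (exp (- \<tau>)) y ** Y (exp (- \<tau>)) y) = G (exp (- \<tau>)) y ** Y (exp (- \<tau>)) y"
      by (simp add: Y_def GX transpose_Gy[OF t])
    show "(G (exp (- \<tau>)) has_vector_derivative G (exp (- \<tau>)) y ** Y (exp (- \<tau>)) y) (at y)"
      using Gy[OF t] by (simp add: Y_def GX)
    show "((\<lambda>s. (- exp (- s)) *\<^sub>R X (exp (- s)) y) has_vector_derivative
        (exp (- \<tau>))\<^sup>2 *\<^sub>R Xt (exp (- \<tau>)) y + exp (- \<tau>) *\<^sub>R X (exp (- \<tau>)) y) (at \<tau> within {\<tau>0..})"
      using has_vector_derivative_scaleR[OF DERIV_minus[OF e] chain[OF \<tau> logarithmic_derivs(1)[OF t]]]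
      by (simp add: power2_eq_square)
    show "((\<lambda>y. (- exp (- \<tau>)) *\<^sub>R X (exp (- \<tau>)) y) has_vector_derivative (- exp (- \<tau>)) *\<^sub>R Xy (exp (- \<tau>)) y) (at y)"
      by (rule bounded_linear.has_vector_derivative[OF bounded_linear_scaleR_right logarithmic_derivs(2)[OF t]])
    \<comment> \<open>This is Yt = Xy + Y X - X Y, multiplied by the derivative - exp (- \<tau>) of
      t.\<close>
    show "((\<lambda>s. Y (exp (- s)) y) has_vector_derivative
        (- exp (- \<tau>)) *\<^sub>R Xy (exp (- \<tau>)) y + Y (exp (- \<tau>)) y ** ((- exp (- \<tau>)) *\<^sub>R X (exp (- \<tau>)) y)
        - (- exp (- \<tau>)) *\<^sub>R X (exp (- \<tau>)) y ** Y (exp (- \<tau>)) y) (at \<tau> within {\<tau>0..})"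
      using chain[OF \<tau> logarithmic_derivs(3)[OF t]]
      by (simp add: Xy_def Yt_def matrix_mult.scaleR_left matrix_mult.scaleR_right matrix_mult.minus_left matrix_mult.minus_right scaleR_diff_right)
    show "((\<lambda>z. (1 / dens t0 z) *\<^sub>R Y (exp (- \<tau>)) z) has_vector_derivative
        (dens t0 y * exp (real CARD('n) * \<tau>) / (real CARD('n))\<^sup>2) *\<^sub>R
        ((exp (- \<tau>))\<^sup>2 *\<^sub>R Xt (exp (- \<tau>)) y + exp (- \<tau>) *\<^sub>R X (exp (- \<tau>)) y)) (at y)"
    proof -
      have 1: "exp (- \<tau>) ^ CARD('n) = inverse (exp (real CARD('n) * \<tau>))"
        by (simp add: exp_minus power_inverse flip: exp_of_nat_mult)
      have 2: "(exp (- \<tau>))\<^sup>2 *\<^sub>R Xt (exp (- \<tau>)) y + exp (- \<tau>) *\<^sub>R X (exp (- \<tau>)) y =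
        (exp (- \<tau>))\<^sup>2 *\<^sub>R (Xt (exp (- \<tau>)) y + (1 / exp (- \<tau>)) *\<^sub>R X (exp (- \<tau>)) y)"
        by (simp add: scaleR_add_right power2_eq_square)
      show ?thesis
        using wave_equation[OF t, of y] unfolding 2 1 by (simp add: field_simps)
    qed
  next
    fix \<tau> y and v :: "real^'n" assume "\<tau> \<ge> \<tau>0" "v \<noteq> 0"
    then show "0 < v \<bullet> (G (exp (- \<tau>)) y *v v)"
      using posdef_G dom by blast
  qed (auto simp: case_prod_unfold X_def Y_def Xt_def Xy_def intro!: cont_intros)
qed

text \<open>\<open>Ginv_Gtau_tau\<close> nests two derivatives taken within the half-line. The inner
  one is - t Gt at every s >= \<tau>0, end point included, so the outer function agrees with
  \<open>U\<close> on the whole half-line and its derivative is the one from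
  \<open>gowdy_wave\<close>.\<close>

lemma Ginv_Gtau_tau_eq:
  assumes t0: "t0 = exp (- \<tau>0)" and \<tau>: "\<tau> \<ge> \<tau>0"
  shows "Ginv_Gtau_tau \<tau>0 G \<tau> y = (exp (- \<tau>))\<^sup>2 *\<^sub>R Xt (exp (- \<tau>)) y + exp (- \<tau>) *\<^sub>R X (exp (- \<tau>)) y"
proof -
  interpret gowdy_wave A \<tau>0 "real CARD('n)" "\<lambda>\<tau>. G (exp (- \<tau>))"
    "\<lambda>\<tau> y. (- exp (- \<tau>)) *\<^sub>R X (exp (- \<tau>)) y" "\<lambda>\<tau>. Y (exp (- \<tau>))"
    "\<lambda>\<tau> y. (exp (- \<tau>))\<^sup>2 *\<^sub>R Xt (exp (- \<tau>)) y + exp (- \<tau>) *\<^sub>R X (exp (- \<tau>)) y"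
    "\<lambda>\<tau> y. (- exp (- \<tau>)) *\<^sub>R Xy (exp (- \<tau>)) y" "dens t0"
    by (rule gowdy_wave[OF t0])
  have nontriv: "at s within {\<tau>0..} \<noteq> bot" if "s \<ge> \<tau>0" for s
  proof -
    have "{s<..<s + 1} \<subseteq> {\<tau>0..}"
      using that by auto
    then show ?thesis
      using islimpt_subset[OF islimpt_greaterThanLessThan1[of s "s + 1"]] by (auto simp: trivial_limit_within)
  qed
  have "vector_derivative (\<lambda>r. G (exp (- r)) y) (at s within {\<tau>0..}) = (- exp (- s)) *\<^sub>R Gt (exp (- s)) y"
    if s: "s \<ge> \<tau>0" for s
  proof (rule vector_derivative_within[OF nontriv[OF s]])
    have "((\<lambda>s. exp (- s)) has_vector_derivative - exp (- s)) (at s within {\<tau>0..})"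
      by (auto intro!: derivative_eq_intros simp flip: has_real_derivative_iff_has_vector_derivative)
    moreover have "((\<lambda>r. G r y) has_vector_derivative Gt (exp (- s)) y) (at (exp (- s)) within (\<lambda>s. exp (- s)) ` {\<tau>0..})"
      by (rule has_vector_derivative_within_subset[OF Gt]) (use s t0 in auto)
    ultimately show "((\<lambda>r. G (exp (- r)) y) has_vector_derivative (- exp (- s)) *\<^sub>R Gt (exp (- s)) y) (at s within {\<tau>0..})"
      using vector_diff_chain_within by (fastforce simp: o_def)
  qed
  then have "((\<lambda>s. matrix_inv (G (exp (- s)) y) ** vector_derivative (\<lambda>r. G (exp (- r)) y) (at s within {\<tau>0..}))
      has_vector_derivative (exp (- \<tau>))\<^sup>2 *\<^sub>R Xt (exp (- \<tau>)) y + exp (- \<tau>) *\<^sub>R X (exp (- \<tau>)) y) (at \<tau> within {\<tau>0..})"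
    by (intro has_vector_derivative_transform[OF _ _ U_\<tau>[OF \<tau>]])
      (use \<tau> in \<open>auto simp: X_def matrix_mult.scaleR_right matrix_mult.minus_right\<close>)
  then show ?thesis
    unfolding Ginv_Gtau_tau_def by (rule vector_derivative_within[OF nontriv[OF \<tau>]])
qed

end

lemma (in gowdy_spacetime) ex_gowdy_partials:
  "\<exists>Gt Gy Gtt Gty Gyy Lt Ly ht hy. gowdy_partials t0 A G L h Gt Gy Gtt Gty Gyy Lt Ly ht hy"
proof -
  have "Ck_on (Suc (Suc 0)) ({0<..t0} \<times> UNIV) (\<lambda>(t, y). G t y)"
    using smooth_G unfolding smooth_on_def by blast
  then obtain Gt Gy where
    G1: "Ck_on (Suc 0) ({0<..t0} \<times> UNIV) (\<lambda>(t, y). Gt t y)" "Ck_on (Suc 0) ({0<..t0} \<times> UNIV) (\<lambda>(t, y). Gy t y)"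
    and Gt: "\<And>t y. t \<in> {0<..t0} \<Longrightarrow> ((\<lambda>s. G s y) has_vector_derivative Gt t y) (at t within {0<..t0})"
    and Gy: "\<And>t y. t \<in> {0<..t0} \<Longrightarrow> (G t has_vector_derivative Gy t y) (at y)"
    by (rule Ck_on_partials) blast
  from G1(1) obtain Gtt Gty where
    Gt2: "Ck_on 0 ({0<..t0} \<times> UNIV) (\<lambda>(t, y). Gtt t y)" "Ck_on 0 ({0<..t0} \<times> UNIV) (\<lambda>(t, y). Gty t y)"
    and Gtt: "\<And>t y. t \<in> {0<..t0} \<Longrightarrow> ((\<lambda>s. Gt s y) has_vector_derivative Gtt t y) (at t within {0<..t0})"
    and Gty: "\<And>t y. t \<in> {0<..t0} \<Longrightarrow> (Gt t has_vector_derivative Gty t y) (at y)"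
    by (rule Ck_on_partials) blast
  from G1(2) obtain Gyt Gyy where
    Gy2: "Ck_on 0 ({0<..t0} \<times> UNIV) (\<lambda>(t, y). Gyt t y)" "Ck_on 0 ({0<..t0} \<times> UNIV) (\<lambda>(t, y). Gyy t y)"
    and Gyt: "\<And>t y. t \<in> {0<..t0} \<Longrightarrow> ((\<lambda>s. Gy s y) has_vector_derivative Gyt t y) (at t within {0<..t0})"
    and Gyy: "\<And>t y. t \<in> {0<..t0} \<Longrightarrow> (Gy t has_vector_derivative Gyy t y) (at y)"
    by (rule Ck_on_partials) blast
  have "Ck_on (Suc 0) ({0<..t0} \<times> UNIV) (\<lambda>(t, y). L t y)"
    using smooth_L unfolding smooth_on_def by blast
  then obtain Lt Ly where
    Lt: "\<And>t y. t \<in> {0<..t0} \<Longrightarrow> ((\<lambda>s. L s y) has_vector_derivative Lt t y) (at t within {0<..t0})"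
    and Ly: "\<And>t y. t \<in> {0<..t0} \<Longrightarrow> (L t has_vector_derivative Ly t y) (at y)"
    by (rule Ck_on_partials) blast
  have "Ck_on (Suc 0) ({0<..t0} \<times> UNIV) (\<lambda>(t, y). h t y)"
    using smooth_h unfolding smooth_on_def by blast
  then obtain ht hy where
    ht: "\<And>t y. t \<in> {0<..t0} \<Longrightarrow> ((\<lambda>s. h s y) has_vector_derivative ht t y) (at t within {0<..t0})"
    and hy: "\<And>t y. t \<in> {0<..t0} \<Longrightarrow> (h t has_vector_derivative hy t y) (at y)"
    by (rule Ck_on_partials) blast
  have eq: "Gyt t y = Gty t y" if t: "t \<in> {0<..t0}" for t y
  proof -
    \<comment> \<open>The symmetry of mixed partials is proved on closed intervals, whereas t = 0
      lies outside the domain; [t / 2, t0] is a closed interval in the domain that contains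
      t.\<close>
    have sub: "{t / 2..t0} \<subseteq> {0<..t0}"
      using t by auto
    show ?thesis
    proof (rule mixed_partials_Icc[of "t / 2" t0 G Gt Gy Gty Gyt])
      show "continuous_on ({t / 2..t0} \<times> UNIV) (\<lambda>(t, y). Gt t y)"
        "continuous_on ({t / 2..t0} \<times> UNIV) (\<lambda>(t, y). Gty t y)"
        by (rule continuous_on_subset[OF Ck_on_imp_continuous_on[OF G1(1)]] continuous_on_subset[OF Ck_on_imp_continuous_on[OF Gt2(2)]],
            use sub in blast)+
    qed (use t sub in \<open>auto intro: Gy Gty has_vector_derivative_within_subset[OF Gt] has_vector_derivative_within_subset[OF Gyt]\<close>)
  qed
  have "gowdy_partials t0 A G L h Gt Gy Gtt Gty Gyy Lt Ly ht hy"
    using Gt Gy Gtt Gty Gyt Gyy Lt Ly ht hy G1[THEN Ck_on_imp_continuous_on] Gt2 Gy2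
    by unfold_locales (simp_all add: eq has_real_derivative_iff_has_vector_derivative)
  then show ?thesis
    by blast
qed

theorem theorem1p3:
  fixes t0 \<tau>0 :: real
    and A :: "real^'n::finite^'n"
    and G :: "real \<Rightarrow> real \<Rightarrow> real^'n^'n"
    and L h :: "real \<Rightarrow> real \<Rightarrow> real"
    and F :: "real \<Rightarrow> ennreal"
  assumes "gowdy_spacetime t0 A G L h"
    and "t0 = exp (- \<tau>0)"
  defines "F \<equiv> (\<lambda>\<tau>. ennreal (exp (real CARD('n) * \<tau>)) *
      (Hminus1_norm A (G (exp (- \<tau>))) (gowdy_density t0 G L h (exp (- \<tau>))) (Ginv_Gtau_tau \<tau>0 G \<tau>))\<^sup>2)"
  shows "F \<in> borel_measurable (restrict_space lborel {\<tau>0..}) \<and> (\<integral>\<^sup>+\<tau>\<in>{\<tau>0..}. F \<tau> \<partial>lborel) < \<infinity>"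
proof -
  obtain Gt Gy Gtt Gty Gyy Lt Ly ht hy where "gowdy_partials t0 A G L h Gt Gy Gtt Gty Gyy Lt Ly ht hy"
    using gowdy_spacetime.ex_gowdy_partials[OF assms(1)] by blast
  then interpret g: gowdy_partials t0 A G L h Gt Gy Gtt Gty Gyy Lt Ly ht hy .
  define \<eta> where "\<eta> = (\<lambda>\<tau> y. (exp (- \<tau>))\<^sup>2 *\<^sub>R g.Xt (exp (- \<tau>)) y + exp (- \<tau>) *\<^sub>R g.X (exp (- \<tau>)) y)"
  interpret w: gowdy_wave A \<tau>0 "real CARD('n)" "\<lambda>\<tau>. G (exp (- \<tau>))"
    "\<lambda>\<tau> y. (- exp (- \<tau>)) *\<^sub>R g.X (exp (- \<tau>)) y" "\<lambda>\<tau>. g.Y (exp (- \<tau>))" \<eta>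
    "\<lambda>\<tau> y. (- exp (- \<tau>)) *\<^sub>R g.Xy (exp (- \<tau>)) y" "g.dens t0"
    unfolding \<eta>_def by (rule g.gowdy_wave[OF assms(2)])
  define F' where "F' \<tau> = ennreal (exp (real CARD('n) * \<tau>)) * (Hminus1_norm A (G (exp (- \<tau>))) (g.dens t0) (\<eta> \<tau>))\<^sup>2" for \<tau>
  \<comment> \<open>The two integrands are compared only for \<tau> >= \<tau>0; for smaller \<tau>
    the indicator, or the restriction of the measure space, hides any difference.\<close>
  have F: "F \<tau> = F' \<tau>" if \<tau>: "\<tau> \<ge> \<tau>0" for \<tau>
  proof -
    have t: "exp (- \<tau>) \<in> {0<..t0}"
      using \<tau> assms(2) by simp
    have "gowdy_density t0 G L h (exp (- \<tau>)) = g.dens t0"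
      using g.gowdy_density_eq[OF t] g.dens_const[OF t] by auto
    moreover have "Ginv_Gtau_tau \<tau>0 G \<tau> = \<eta> \<tau>"
      using g.Ginv_Gtau_tau_eq[OF assms(2) \<tau>] by (auto simp: \<eta>_def)
    ultimately show ?thesis
      by (simp add: F_def F'_def)
  qed
  have "(\<lambda>\<tau>. ennreal (exp (real CARD('n) * \<tau>))) \<in> borel_measurable (restrict_space lborel {\<tau>0..})"
    by (rule measurable_restrict_space1) measurable
  then have "F' \<in> borel_measurable (restrict_space lborel {\<tau>0..})"
    unfolding F'_def[abs_def] power2_eq_square by (intro borel_measurable_times_ennreal w.measurable_Hminus1_norm)
  then have "F \<in> borel_measurable (restrict_space lborel {\<tau>0..})"
    by (rule measurable_cong[THEN iffD1, rotated]) (simp add: space_restrict_space F)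
  moreover have "(\<integral>\<^sup>+\<tau>\<in>{\<tau>0..}. F \<tau> \<partial>lborel) = (\<integral>\<^sup>+\<tau>\<in>{\<tau>0..}. F' \<tau> \<partial>lborel)"
    by (intro nn_integral_cong) (auto simp: F split: split_indicator)
  ultimately show ?thesis
    using w.nn_integral_Hminus1_norm_finite by (simp add: F'_def)
qed

end
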